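(* Let $n \in \mathbb{N}$ and $\delta \in (0,1)$ be parameters such that $\delta > O(1/n)$ (i.e., $\delta \ge C_0/n$ for a suitable absolute constant $C_0$) and $\delta^{-1}$ is a power of two. Then there exists an open-addressed hash table without reordering (a pair $(\mathcal{P},\mathcal{A})$) that supports $n - \lfloor \delta n \rfloor$ insertions into an array of size $n$ and that has amortized expected probe complexity $O(1)$, worst-case expected probe complexity $O(\log \delta^{-1})$, and worst-case expected insertion time $O(\log \delta^{-1})$, where the implied constants are absolute.
   Context: An open-addressed hash table without reordering with capacity $n$ consists of an array of $n$ slots indexed by $[n]=\{1,\dots,n\}$, initially empty. Keys $x_1,x_2,\dots$ are inserted one after another. Each key $x$ comes with an infinite probe sequence $h_1(x),h_2(x),\dots \in [n]^{\infty}$, and the probe sequences of the keys are drawn independently from a common distribution $\mathcal{P}$. To insert $x$, an insertion algorithm $\mathcal{A}$ (which may examine slots to see whether they are occupied) must place $x$ into some currently unoccupied slot $h_j(x)$; elements are never moved after being placed. If $x$ is placed in slot $h_j(x)$, then $x$ has probe complexity $j$. The insertion time of an insertion is the number of slots it examines. The amortized expected probe complexity is the expected value of the average probe complexity over all inserted keys; the worst-case expected probe complexity is the maximum, over all insertions, of the expected probe complexity of the inserted key (similarly for worst-case expected insertion time). $\log$ denotes the base-2 logarithm. *)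

theory Defs
  imports "HOL-Probability.Probability"
begin

section \<open>Random keys\<close>

text \<open>
  A key is represented by its probe sequence \<open>h 1, h 2, \<dots>\<close>; the sequences of the keys
  \<open>1, \<dots>, m\<close> are drawn independently from a common distribution \<open>P\<close>.
\<close>

type_synonym probe_seq = "nat \<Rightarrow> nat"

definition probe_space :: "nat \<Rightarrow> probe_seq measure" where
  "probe_space n = PiM {1..} (\<lambda>_. count_space {1..n})"

definition probe_distribution :: "nat \<Rightarrow> probe_seq measure \<Rightarrow> bool" where
  "probe_distribution n P \<longleftrightarrow> prob_space P \<and> sets P = sets (probe_space n)"

definition keys :: "nat \<Rightarrow> probe_seq measure \<Rightarrow> (nat \<Rightarrow> probe_seq) measure" where
  "keys m P = PiM {1..m} (\<lambda>_. P)"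


section \<open>Insertion algorithms\<close>

text \<open>
  An insertion is an adaptive sequence of steps.  \<open>Examine s\<close> asks whether slot \<open>s\<close> is
  occupied; \<open>Place j mem'\<close> ends the insertion, puts the key into slot \<open>h j\<close> and stores \<open>mem'\<close>
  for the next insertion.  The next step depends on the stored number \<open>mem\<close> (initially 0), the
  probe sequence of the key, and the transcript of the current insertion: the slots examined so
  far, each with the answer received (\<open>True\<close> for occupied).
  In particular the array itself is visible to the algorithm only through \<open>Examine\<close>.
\<close>

datatype action = Examine nat | Place nat nat

type_synonym transcript = "(nat \<times> bool) list"

type_synonym algorithm = "nat \<Rightarrow> probe_seq \<Rightarrow> transcript \<Rightarrow> action"

text \<open>
  Unbounded memory would let an algorithm remember the whole array and never examine an occupied
  slot.  The memory carried from one insertion to the next is therefore limited to \<open>M\<close> values;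
  with \<open>M = n ^ K\<close> these are \<open>K\<close> words of \<open>log n\<close> bits, as needed for counters.
  Measurability makes the expectations below meaningful.
\<close>

definition insertion_algorithm :: "nat \<Rightarrow> nat \<Rightarrow> algorithm \<Rightarrow> bool" where
  "insertion_algorithm n M A \<longleftrightarrow>
     (\<forall>mem tr. (\<lambda>h. A mem h tr) \<in> probe_space n \<rightarrow>\<^sub>M count_space UNIV) \<and>
     (\<forall>mem h tr j mem'. A mem h tr = Place j mem' \<longrightarrow> mem' < M)"

text \<open>
  The insertion of a key with probe sequence \<open>h\<close> into an array with set \<open>occ\<close> of occupied slots
  returns the probe complexity, the insertion time and the new memory.
  The result is \<open>None\<close> if the insertion never ends or if the algorithm tries to place the key into
  a slot that it has not examined and found empty during this insertion.
\<close>

partial_function (option) run ::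
  "algorithm \<Rightarrow> nat set \<Rightarrow> nat \<Rightarrow> probe_seq \<Rightarrow> transcript \<Rightarrow> (nat \<times> nat \<times> nat) option" where
  "run A occ mem h tr =
     (case A mem h tr of
        Examine s \<Rightarrow> run A occ mem h (tr @ [(s, s \<in> occ)])
      | Place j mem' \<Rightarrow>
          if 1 \<le> j \<and> (h j, False) \<in> set tr then Some (j, length tr, mem') else None)"

definition insert_key ::
  "algorithm \<Rightarrow> nat set \<Rightarrow> nat \<Rightarrow> probe_seq \<Rightarrow> (nat \<times> nat \<times> nat) option" where
  "insert_key A occ mem h = run A occ mem h []"

text \<open>Occupied slots and memory after the first \<open>k\<close> insertions:\<close>

primrec table :: "algorithm \<Rightarrow> (nat \<Rightarrow> probe_seq) \<Rightarrow> nat \<Rightarrow> (nat set \<times> nat) option" where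
  "table A \<omega> 0 = Some ({}, 0)"
| "table A \<omega> (Suc k) =
     (case table A \<omega> k of
        None \<Rightarrow> None
      | Some (occ, mem) \<Rightarrow>
          (case insert_key A occ mem (\<omega> (Suc k)) of
             None \<Rightarrow> None
           | Some (j, t, mem') \<Rightarrow> Some (insert (\<omega> (Suc k) j) occ, mem')))"

text \<open>Result of the \<open>k\<close>-th insertion, for \<open>k \<ge> 1\<close>:\<close>

definition outcome :: "algorithm \<Rightarrow> nat \<Rightarrow> (nat \<Rightarrow> probe_seq) \<Rightarrow> (nat \<times> nat \<times> nat) option" where
  "outcome A k \<omega> =
     (case table A \<omega> (k - 1) of
        None \<Rightarrow> None
      | Some (occ, mem) \<Rightarrow> insert_key A occ mem (\<omega> k))"

definition probe_complexity :: "algorithm \<Rightarrow> nat \<Rightarrow> (nat \<Rightarrow> probe_seq) \<Rightarrow> ennreal" where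
  "probe_complexity A k \<omega> =
     (case outcome A k \<omega> of None \<Rightarrow> \<infinity> | Some (j, t, mem') \<Rightarrow> of_nat j)"

definition insertion_time :: "algorithm \<Rightarrow> nat \<Rightarrow> (nat \<Rightarrow> probe_seq) \<Rightarrow> ennreal" where
  "insertion_time A k \<omega> =
     (case outcome A k \<omega> of None \<Rightarrow> \<infinity> | Some (j, t, mem') \<Rightarrow> of_nat t)"


section \<open>Performance of a hash table\<close>

definition supports_insertions :: "probe_seq measure \<Rightarrow> algorithm \<Rightarrow> nat \<Rightarrow> bool" where
  "supports_insertions P A m \<longleftrightarrow> (AE \<omega> in keys m P. \<forall>k\<in>{1..m}. outcome A k \<omega> \<noteq> None)"

definition amortized_expected_probe_complexity ::
  "probe_seq measure \<Rightarrow> algorithm \<Rightarrow> nat \<Rightarrow> ennreal" where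
  "amortized_expected_probe_complexity P A m =
     (\<integral>\<^sup>+\<omega>. (\<Sum>k = 1..m. probe_complexity A k \<omega>) / of_nat m \<partial>keys m P)"

definition worst_case_expected_probe_complexity ::
  "probe_seq measure \<Rightarrow> algorithm \<Rightarrow> nat \<Rightarrow> ennreal" where
  "worst_case_expected_probe_complexity P A m =
     (SUP k\<in>{1..m}. \<integral>\<^sup>+\<omega>. probe_complexity A k \<omega> \<partial>keys m P)"

definition worst_case_expected_insertion_time ::
  "probe_seq measure \<Rightarrow> algorithm \<Rightarrow> nat \<Rightarrow> ennreal" where
  "worst_case_expected_insertion_time P A m =
     (SUP k\<in>{1..m}. \<integral>\<^sup>+\<omega>. insertion_time A k \<omega> \<partial>keys m P)"


section \<open>Measurability of the cost functions\<close>

instance action :: countable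
  by countable_datatype

primrec run_fuel ::
  "nat \<Rightarrow> algorithm \<Rightarrow> nat set \<Rightarrow> nat \<Rightarrow> probe_seq \<Rightarrow> transcript \<Rightarrow> (nat \<times> nat \<times> nat) option" where
  "run_fuel 0 A occ mem h tr = None"
| "run_fuel (Suc f) A occ mem h tr =
     (case A mem h tr of
        Examine s \<Rightarrow> run_fuel f A occ mem h (tr @ [(s, s \<in> occ)])
      | Place j mem' \<Rightarrow>
          if 1 \<le> j \<and> (h j, False) \<in> set tr then Some (j, length tr, mem') else None)"

lemma run_eq_Some_iff: "run A occ mem h tr = Some r \<longleftrightarrow> (\<exists>f. run_fuel f A occ mem h tr = Some r)"
proof
  assume "run A occ mem h tr = Some r"
  then show "\<exists>f. run_fuel f A occ mem h tr = Some r"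
  proof (rule run.raw_induct[where P =
        "\<lambda>A occ mem h tr r. \<exists>f. run_fuel f A occ mem h tr = Some r", rotated])
    fix run' :: "algorithm \<Rightarrow> nat set \<Rightarrow> nat \<Rightarrow> probe_seq \<Rightarrow> transcript \<Rightarrow> (nat \<times> nat \<times> nat) option"
      and A occ mem h tr r
    assume IH: "\<And>A occ mem h tr r. run' A occ mem h tr = Some r \<Longrightarrow>
        \<exists>f. run_fuel f A occ mem h tr = Some r"
      and step: "(case A mem h tr of
            Examine s \<Rightarrow> run' A occ mem h (tr @ [(s, s \<in> occ)])
          | Place j mem' \<Rightarrow>
              if 1 \<le> j \<and> (h j, False) \<in> set tr then Some (j, length tr, mem') else None) = Some r"
    show "\<exists>f. run_fuel f A occ mem h tr = Some r"
    proof (cases "A mem h tr")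
      case (Examine s)
      with step have "run' A occ mem h (tr @ [(s, s \<in> occ)]) = Some r" by simp
      from IH[OF this] obtain f where "run_fuel f A occ mem h (tr @ [(s, s \<in> occ)]) = Some r" ..
      with Examine have "run_fuel (Suc f) A occ mem h tr = Some r" by simp
      then show ?thesis ..
    next
      case (Place j mem')
      with step have "run_fuel (Suc 0) A occ mem h tr = Some r" by simp
      then show ?thesis ..
    qed
  qed
next
  assume "\<exists>f. run_fuel f A occ mem h tr = Some r"
  then obtain f where "run_fuel f A occ mem h tr = Some r" ..
  then show "run A occ mem h tr = Some r"
  proof (induction f arbitrary: tr)
    case (Suc f)
    then show ?case by (subst run.simps) (auto split: action.splits)
  qed simp
qed

lemma measurable_probe:
  assumes "1 \<le> j"
  shows "(\<lambda>h. h j) \<in> probe_space n \<rightarrow>\<^sub>M count_space UNIV"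
proof -
  have "(\<lambda>h. h j) \<in> probe_space n \<rightarrow>\<^sub>M count_space {1..n}"
    unfolding probe_space_def using assms by (intro measurable_component_singleton) auto
  then show ?thesis
    by (rule measurable_compose) simp
qed

lemma measurable_run_fuel:
  assumes "insertion_algorithm n M A"
  shows "(\<lambda>h. run_fuel f A occ mem h tr) \<in> probe_space n \<rightarrow>\<^sub>M count_space UNIV"
proof (induction f arbitrary: tr)
  case (Suc f)
  have place: "(\<lambda>h. if 1 \<le> j \<and> (h j, False) \<in> set tr then Some (j, length tr, mem') else None)
      \<in> probe_space n \<rightarrow>\<^sub>M count_space UNIV" for j mem'
  proof (cases "1 \<le> j")
    case True
    from measurable_compose[OF measurable_probe[OF True],
        of "\<lambda>s. if (s, False) \<in> set tr then Some (j, length tr, mem') else None" "count_space UNIV"]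
    show ?thesis using True by simp
  qed simp
  have "(\<lambda>h. case a of
        Examine s \<Rightarrow> run_fuel f A occ mem h (tr @ [(s, s \<in> occ)])
      | Place j mem' \<Rightarrow>
          if 1 \<le> j \<and> (h j, False) \<in> set tr then Some (j, length tr, mem') else None)
      \<in> probe_space n \<rightarrow>\<^sub>M count_space UNIV" for a
  proof (cases a)
    case (Examine s)
    then show ?thesis by (simp only: action.case) (rule Suc)
  next
    case (Place j mem')
    then show ?thesis by (simp only: action.case) (rule place)
  qed
  moreover have "(\<lambda>h. A mem h tr) \<in> probe_space n \<rightarrow>\<^sub>M count_space UNIV"
    using assms by (simp add: insertion_algorithm_def)
  ultimately show ?case
    unfolding run_fuel.simps by (rule measurable_compose_countable)
qed simp

lemma measurable_insert_key:
  assumes "insertion_algorithm n M A"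
  shows "(\<lambda>h. insert_key A occ mem h) \<in> probe_space n \<rightarrow>\<^sub>M count_space UNIV"
proof -
  let ?S = "\<lambda>r. {h \<in> space (probe_space n). insert_key A occ mem h = Some r}"
  have eq: "?S r = (\<Union>f. (\<lambda>h. run_fuel f A occ mem h []) -` {Some r} \<inter> space (probe_space n))" for r
    by (auto simp: insert_key_def run_eq_Some_iff)
  have some: "?S r \<in> sets (probe_space n)" for r
    unfolding eq by (intro sets.countable_UN) (auto intro: measurable_sets[OF measurable_run_fuel[OF assms]])
  have "(\<lambda>h. insert_key A occ mem h) -` {v} \<inter> space (probe_space n) \<in> sets (probe_space n)" for v
  proof (cases v)
    case None
    have "(\<lambda>h. insert_key A occ mem h) -` {v} \<inter> space (probe_space n)
        = space (probe_space n) - (\<Union>r. ?S r)"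
      using None by (auto simp del: split_paired_All split_paired_Ex)
    moreover have "(\<Union>r. ?S r) \<in> sets (probe_space n)"
      by (rule sets.countable_UN) (use some in auto)
    ultimately show ?thesis by auto
  next
    case (Some r)
    have "(\<lambda>h. insert_key A occ mem h) -` {v} \<inter> space (probe_space n) = ?S r"
      using Some by auto
    with some show ?thesis by simp
  qed
  then show ?thesis
    by (simp add: measurable_count_space_eq2_countable)
qed

lemma measurable_key:
  assumes "probe_distribution n P" "1 \<le> k" "k \<le> m"
  shows "(\<lambda>\<omega>. \<omega> k) \<in> keys m P \<rightarrow>\<^sub>M probe_space n"
proof -
  have "(\<lambda>\<omega>. \<omega> k) \<in> keys m P \<rightarrow>\<^sub>M P"
    unfolding keys_def using assms by (intro measurable_component_singleton) auto
  then show ?thesis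
    using assms(1) by (simp add: probe_distribution_def cong: measurable_cong_sets)
qed

definition table_states :: "(nat set \<times> nat) option set" where
  "table_states = insert None (Some ` ({X. finite X} \<times> UNIV))"

lemma countable_table_states: "countable table_states"
  unfolding table_states_def
  by (intro countable_insert countable_image countable_SIGMA countable_Collect_finite) simp

lemma table_in_table_states: "table A \<omega> k \<in> table_states"
  by (induction k) (auto simp: table_states_def split: option.splits)

lemma measurable_table:
  assumes A: "insertion_algorithm n M A" and P: "probe_distribution n P" and "k \<le> m"
  shows "(\<lambda>\<omega>. table A \<omega> k) \<in> keys m P \<rightarrow>\<^sub>M count_space table_states"
  using \<open>k \<le> m\<close>
proof (induction k)
  case 0
  then show ?case by (simp add: table_states_def)
next
  case (Suc k)
  have key: "(\<lambda>\<omega>. \<omega> (Suc k)) \<in> keys m P \<rightarrow>\<^sub>M probe_space n"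
    using Suc.prems by (intro measurable_key[OF P]) auto
  let ?next = "\<lambda>occ r h. case r of None \<Rightarrow> None
      | Some (j, t, mem') \<Rightarrow> Some (insert (h j) occ, mem')"
  have upd: "(\<lambda>h. case insert_key A occ mem h of None \<Rightarrow> None
      | Some (j, t, mem') \<Rightarrow> Some (insert (h j) occ, mem'))
      \<in> probe_space n \<rightarrow>\<^sub>M count_space UNIV" for occ mem
  proof -
    let ?g = "\<lambda>r h. if \<exists>j t mem'. r = Some (j, t, mem') \<and> 1 \<le> j then ?next occ r h else None"
    have "?g r \<in> probe_space n \<rightarrow>\<^sub>M count_space UNIV" for r
    proof (cases "\<exists>j t mem'. r = Some (j, t, mem') \<and> 1 \<le> j")
      case True
      then obtain j t mem' where r: "r = Some (j, t, mem')" and j: "1 \<le> j" by blast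
      from measurable_compose[OF measurable_probe[OF j],
          of "\<lambda>s. Some (insert s occ, mem')" "count_space UNIV"]
      show ?thesis using r j by simp
    next
      case False
      then show ?thesis by (simp only: if_False) simp
    qed
    then have "(\<lambda>h. ?g (insert_key A occ mem h) h) \<in> probe_space n \<rightarrow>\<^sub>M count_space UNIV"
      by (rule measurable_compose_countable) (rule measurable_insert_key[OF A])
    moreover have "?g (insert_key A occ mem h) h = ?next occ (insert_key A occ mem h) h" for h
    proof -
      have "1 \<le> j" if "run_fuel f A occ mem h tr = Some (j, t, mem')" for f tr j t mem'
        using that by (induction f arbitrary: tr) (auto split: action.splits if_splits)
      then have "1 \<le> j" if "insert_key A occ mem h = Some (j, t, mem')" for j t mem'
        using that by (auto simp: insert_key_def run_eq_Some_iff)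
      then show ?thesis by (auto split: option.splits)
    qed
    ultimately show ?thesis by simp
  qed
  have step: "(\<lambda>\<omega>. case s of None \<Rightarrow> None
      | Some (occ, mem) \<Rightarrow> ?next occ (insert_key A occ mem (\<omega> (Suc k))) (\<omega> (Suc k)))
      \<in> keys m P \<rightarrow>\<^sub>M count_space UNIV" for s
    using measurable_compose[OF key upd] by (cases s) (auto split: prod.splits)
  have "(\<lambda>\<omega>. table A \<omega> (Suc k)) \<in> keys m P \<rightarrow>\<^sub>M count_space UNIV"
    unfolding table.simps
    by (rule measurable_compose_countable'[OF step Suc.IH countable_table_states]) (use Suc.prems in simp)
  have "(\<lambda>\<omega>. table A \<omega> (Suc k)) -` {a} \<inter> space (keys m P) \<in> sets (keys m P)" for a
    by (rule measurable_sets[OF \<open>(\<lambda>\<omega>. table A \<omega> (Suc k)) \<in> keys m P \<rightarrow>\<^sub>M count_space UNIV\<close>]) simp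
  moreover have "(\<lambda>\<omega>. table A \<omega> (Suc k)) \<in> space (keys m P) \<rightarrow> table_states"
    by (rule funcsetI) (rule table_in_table_states)
  ultimately show ?case
    by (intro iffD2[OF measurable_count_space_eq_countable[OF countable_table_states]] conjI ballI)
qed

lemma measurable_outcome:
  assumes A: "insertion_algorithm n M A" and P: "probe_distribution n P"
    and k: "1 \<le> k" "k \<le> m"
  shows "outcome A k \<in> keys m P \<rightarrow>\<^sub>M count_space UNIV"
proof -
  have step: "(\<lambda>\<omega>. case s of None \<Rightarrow> None | Some (occ, mem) \<Rightarrow> insert_key A occ mem (\<omega> k))
      \<in> keys m P \<rightarrow>\<^sub>M count_space UNIV" for s
    using measurable_compose[OF measurable_key[OF P k] measurable_insert_key[OF A]]
    by (cases s) (auto split: prod.splits)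
  have "(\<lambda>\<omega>. outcome A k \<omega>) \<in> keys m P \<rightarrow>\<^sub>M count_space UNIV"
    unfolding outcome_def
    by (rule measurable_compose_countable'[OF step measurable_table[OF A P] countable_table_states])
      (use k in simp)
  then show ?thesis by simp
qed

lemma borel_measurable_costs:
  assumes "insertion_algorithm n M A" "probe_distribution n P" "1 \<le> k" "k \<le> m"
  shows "probe_complexity A k \<in> borel_measurable (keys m P)"
    and "insertion_time A k \<in> borel_measurable (keys m P)"
proof -
  have "(\<lambda>\<omega>. f (outcome A k \<omega>)) \<in> borel_measurable (keys m P)"
    for f :: "(nat \<times> nat \<times> nat) option \<Rightarrow> ennreal"
    by (rule measurable_compose[OF measurable_outcome[OF assms]]) simp
  from this[of "\<lambda>v. case v of None \<Rightarrow> \<infinity> | Some (j, t, mem') \<Rightarrow> of_nat j"]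
    this[of "\<lambda>v. case v of None \<Rightarrow> \<infinity> | Some (j, t, mem') \<Rightarrow> of_nat t"]
  show "probe_complexity A k \<in> borel_measurable (keys m P)"
    and "insertion_time A k \<in> borel_measurable (keys m P)"
    by (simp_all only: probe_complexity_def[abs_def] insertion_time_def[abs_def])
qed

end

theory Submission
  imports Defs
begin

text \<open>
  The array is cut into levels \<open>slots 0, \<dots>, slots p\<close> of geometrically decreasing size, which are filled one
  after the other.  While level \<open>i\<close> is being filled and has \<open>a\<close> free slots among \<open>N\<close>, a key first makes
  about \<open>C * min (sqrt (N / a)) p\<close> random attempts in level \<open>i\<close>; if all of them fail, it goes to level
  \<open>i + 1\<close>, which is at most half full, so that a constant expected number of further probes suffices.
  Many attempts are thus made only when few of them succeed, and the expected cost of a key is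
  proportional to the cost of addressing level \<open>i\<close>.

  This works as long as level \<open>i + 1\<close> has not received more than \<open>N / 8\<close> keys.  The number of keys that
  overflow while \<open>a\<close> slots are free has mean at most \<open>(sqrt (N / a) + N / (a * p)) / C\<close>, which sums to a
  small multiple of \<open>N\<close>.  The exponential supermartingale \<open>pot\<close> turns this into a tail bound, strong enough
  to pay for the fallback, in which a key probes level \<open>i\<close> until it finds one of the remaining
  \<open>a > N / (4 * 2 ^ p)\<close> free slots.
\<close>

section \<open>Keys as independent random probe sequences\<close>

lemma table_cong:
  assumes "\<And>j. 1 \<le> j \<Longrightarrow> j \<le> k \<Longrightarrow> \<omega> j = \<omega>' j"
  shows "table A \<omega> k = table A \<omega>' k"
  using assms by (induction k) (auto split: option.splits)

text \<open>The state after \<open>k\<close> insertions depends on the first \<open>k\<close> keys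
  only, so by Fubini key \<open>Suc k\<close> can be integrated out as a fresh sample from
  \<open>P\<close> while the state is held fixed. Both sides reduce to an integral over the other
  keys.\<close>

lemma nn_integral_table_key:
  assumes A: "insertion_algorithm n M A" and P: "probe_distribution n P" and k: "k < m"
    and g: "\<And>s. g s \<in> borel_measurable (probe_space n)"
  shows "(\<integral>\<^sup>+\<omega>. g (table A \<omega> k) (\<omega> (Suc k)) \<partial>keys m P)
    = (\<integral>\<^sup>+\<omega>. (\<integral>\<^sup>+h. g (table A \<omega> k) h \<partial>P) \<partial>keys m P)"
proof -
  interpret P: prob_space P using P by (simp add: probe_distribution_def)
  interpret product_sigma_finite "\<lambda>_::nat. P" by standard
  define I where "I = {1..m} - {Suc k}"
  have I: "finite I" "Suc k \<notin> I" and ins: "{1..m} = insert (Suc k) I"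
    using k by (auto simp: I_def)
  have tab: "table A (fun_upd \<omega> (Suc k) h) k = table A \<omega> k" for \<omega> h
    by (rule table_cong) simp
  have key: "(\<lambda>\<omega>. \<omega> (Suc k)) \<in> keys m P \<rightarrow>\<^sub>M probe_space n"
    using k by (intro measurable_key[OF P]) auto
  have mt: "(\<lambda>\<omega>. table A \<omega> k) \<in> keys m P \<rightarrow>\<^sub>M count_space table_states"
    using k by (intro measurable_table[OF A P]) auto
  have "(\<lambda>\<omega>. g (table A \<omega> k) (\<omega> (Suc k))) \<in> borel_measurable (keys m P)"
    by (rule measurable_compose_countable'[OF _ mt countable_table_states])
      (rule measurable_compose[OF key g])
  then have "(\<integral>\<^sup>+\<omega>. g (table A \<omega> k) (\<omega> (Suc k)) \<partial>keys m P)
      = (\<integral>\<^sup>+\<omega>. (\<integral>\<^sup>+h. g (table A \<omega> k) h \<partial>P) \<partial>PiM I (\<lambda>_. P))"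
    unfolding keys_def ins by (subst product_nn_integral_insert[OF I]) (simp_all add: tab)
  moreover have "(\<lambda>\<omega>. \<integral>\<^sup>+h. g (table A \<omega> k) h \<partial>P) \<in> borel_measurable (keys m P)"
    by (rule measurable_compose_countable'[OF _ mt countable_table_states]) simp
  then have "(\<integral>\<^sup>+\<omega>. (\<integral>\<^sup>+h. g (table A \<omega> k) h \<partial>P) \<partial>keys m P)
      = (\<integral>\<^sup>+\<omega>. (\<integral>\<^sup>+h. g (table A \<omega> k) h \<partial>P) \<partial>PiM I (\<lambda>_. P))"
    unfolding keys_def ins
    by (subst product_nn_integral_insert[OF I]) (simp_all add: tab P.emeasure_space_1)
  ultimately show ?thesis by simp
qed

section \<open>First-fit probing along a prescribed order of positions\<close>

text \<open>Examination \<open>t\<close> looks at position \<open>\<pi> mem t\<close>, and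
  \<open>u mem t\<close> is the memory kept after success there. The successful examination is
  itself in the transcript, hence \<open>length tr - 1\<close>. Reducing modulo \<open>B\<close>
  enforces the memory bound on every transcript, including those that no run produces.\<close>

definition first_fit :: "(nat \<Rightarrow> nat \<Rightarrow> nat) \<Rightarrow> (nat \<Rightarrow> nat \<Rightarrow> nat) \<Rightarrow> nat \<Rightarrow> algorithm" where
  "first_fit \<pi> u B mem h tr =
     (if tr \<noteq> [] \<and> \<not> snd (last tr) then Place (\<pi> mem (length tr - 1)) (u mem (length tr - 1) mod B)
      else Examine (h (\<pi> mem (length tr))))"

lemma insertion_algorithm_first_fit:
  assumes "\<And>mem t. 1 \<le> \<pi> mem t" "0 < B"
  shows "insertion_algorithm n B (first_fit \<pi> u B)"
  unfolding insertion_algorithm_def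
proof (intro conjI allI impI)
  show "(\<lambda>h. first_fit \<pi> u B mem h tr) \<in> probe_space n \<rightarrow>\<^sub>M count_space UNIV" for mem tr
  proof (cases "tr \<noteq> [] \<and> \<not> snd (last tr)")
    case False
    have "(\<lambda>h. Examine (h (\<pi> mem (length tr)))) \<in> probe_space n \<rightarrow>\<^sub>M count_space UNIV"
      by (rule measurable_compose[OF measurable_probe]) (use assms in auto)
    with False show ?thesis by (simp only: first_fit_def if_False)
  qed (simp add: first_fit_def)
qed (use assms in \<open>auto simp: first_fit_def split: if_splits\<close>)

text \<open>Backward induction on \<open>d\<close>: a run resumed after \<open>t - d\<close>
  occupied answers ends at examination \<open>t\<close>. The base case unfolds \<open>run\<close>
  twice, once for the free answer and once for the placement.\<close>

lemma insert_key_first_fit: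
  assumes \<pi>: "1 \<le> \<pi> mem t" and free: "h (\<pi> mem t) \<notin> occ"
    and occ: "\<And>s. s < t \<Longrightarrow> h (\<pi> mem s) \<in> occ"
  shows "insert_key (first_fit \<pi> u B) occ mem h = Some (\<pi> mem t, Suc t, u mem t mod B)"
proof -
  define tr where "tr s = map (\<lambda>r. (h (\<pi> mem r), True)) [0..<s]" for s
  have tr_snoc: "tr s @ [(h (\<pi> mem s), True)] = tr (Suc s)" for s
    by (simp add: tr_def)
  have last_tr: "snd (last (tr s))" if "tr s \<noteq> []" for s
    using that by (cases s) (auto simp: tr_def)
  have "run (first_fit \<pi> u B) occ mem h (tr (t - d)) = Some (\<pi> mem t, Suc t, u mem t mod B)"
    if "d \<le> t" for d
    using that
  proof (induction d)
    case 0
    have "first_fit \<pi> u B mem h (tr t) = Examine (h (\<pi> mem t))"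
      using last_tr[of t] by (auto simp: first_fit_def tr_def)
    moreover have "first_fit \<pi> u B mem h (tr t @ [(h (\<pi> mem t), False)]) = Place (\<pi> mem t) (u mem t mod B)"
      by (simp add: first_fit_def tr_def)
    ultimately show ?case using \<pi> free
      by (subst run.simps, simp, subst run.simps, simp add: tr_def)
  next
    case (Suc d)
    let ?s = "t - Suc d"
    have "first_fit \<pi> u B mem h (tr ?s) = Examine (h (\<pi> mem ?s))"
      using last_tr[of ?s] by (auto simp: first_fit_def tr_def)
    moreover have "h (\<pi> mem ?s) \<in> occ" using Suc.prems by (intro occ) auto
    moreover have "Suc ?s = t - d" using Suc.prems by simp
    ultimately show ?case using Suc
      by (subst run.simps) (simp add: tr_snoc)
  qed
  from this[of t] show ?thesis by (simp add: insert_key_def tr_def)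
qed

section \<open>The law of the first sample outside a set\<close>

lemma AE_PiM_all_components:
  fixes \<mu> :: "nat \<Rightarrow> 'a measure"
  assumes "\<And>l. prob_space (\<mu> l)" and "\<And>l. l \<in> I \<Longrightarrow> AE x in \<mu> l. Q l x"
  shows "AE h in PiM I \<mu>. \<forall>l\<in>I. Q l (h l)"
proof -
  interpret product_prob_space \<mu> I
    using assms(1) by (simp add: product_prob_space_def product_prob_space_axioms_def
        product_sigma_finite_def prob_space_imp_sigma_finite)
  have "\<forall>l. AE h in PiM I \<mu>. l \<in> I \<longrightarrow> Q l (h l)"
    using AE_component[OF _ assms(2)] by auto
  then have "AE h in PiM I \<mu>. \<forall>l. l \<in> I \<longrightarrow> Q l (h l)" by (subst AE_all_countable)
  then show ?thesis by eventually_elim blast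
qed

text \<open>Injectivity of \<open>\<pi>\<close> makes the samples independent, so the first one
  outside \<open>X\<close> has index \<open>t\<close> with probability
  \<open>(\<Prod>s<t. F s) * (1 - F t)\<close>. The limit hypothesis excludes that all samples stay
  in \<open>X\<close>; \<open>w t\<close> is the cost of stopping at \<open>t\<close>.\<close>

lemma first_failure_law:
  fixes \<mu> :: "nat \<Rightarrow> 'a measure" and \<pi> :: "nat \<Rightarrow> nat" and w :: "nat \<Rightarrow> real"
  assumes \<mu>: "\<And>l. prob_space (\<mu> l)" and X: "\<And>t. X \<in> sets (\<mu> (\<pi> t))"
    and \<pi>: "inj \<pi>" "\<And>t. \<pi> t \<in> I"
    and F: "\<And>t. measure (\<mu> (\<pi> t)) X = F t"
    and lim: "(\<lambda>t. \<Prod>s<t. F s) \<longlonglongrightarrow> 0"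
    and w: "\<And>t. 0 \<le> w t" and S: "(\<lambda>t. (\<Prod>s<t. F s) * (1 - F t) * w t) sums S"
  shows "AE h in PiM I \<mu>. \<exists>t. h (\<pi> t) \<notin> X"
    and "(\<integral>\<^sup>+h. ennreal (w (LEAST t. h (\<pi> t) \<notin> X)) \<partial>PiM I \<mu>) = ennreal S"
proof -
  interpret product_prob_space \<mu> I
    using \<mu> by (simp add: product_prob_space_def product_prob_space_axioms_def
        product_sigma_finite_def prob_space_imp_sigma_finite)
  let ?P = "PiM I \<mu>"
  define G where "G t = (\<Prod>s<t. F s)" for t
  \<comment> \<open>\<open>U t\<close> is the event that the first \<open>t\<close> samples lie in
    \<open>X\<close>; stopping at \<open>t\<close> is then the event \<open>U t - U (Suc t)\<close>,
    of mass \<open>G t - G (Suc t)\<close>.\<close>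
  define U where "U t = {h \<in> space ?P. \<forall>s<t. h (\<pi> s) \<in> X}" for t
  have U_eq: "U t = {h \<in> space ?P. \<forall>j\<in>\<pi> ` {..<t}. h j \<in> X}" for t
    by (auto simp: U_def)
  have U_meas: "U t \<in> sets ?P" for t
    unfolding U_eq using X \<pi> by (intro sets.sets_Collect_finite_All) auto
  have "emeasure ?P (U t) = ennreal (G t)" for t
  proof -
    have "emeasure ?P (U t) = (\<Prod>j\<in>\<pi> ` {..<t}. emeasure (\<mu> j) X)"
      unfolding U_eq using X \<pi> by (intro emeasure_PiM_Collect) auto
    also have "\<dots> = (\<Prod>s<t. emeasure (\<mu> (\<pi> s)) X)"
      using \<pi>(1) by (intro prod.reindex_cong[of \<pi>]) (auto intro: inj_on_subset)
    also have "\<dots> = (\<Prod>s<t. ennreal (F s))"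
      by (simp add: M.emeasure_eq_measure F)
    also have "\<dots> = ennreal (G t)"
      unfolding G_def by (rule prod_ennreal) (simp flip: F)
    finally show ?thesis .
  qed
  moreover have G_nonneg: "0 \<le> G t" for t
    unfolding G_def by (rule prod_nonneg) (simp flip: F)
  ultimately have U_measure: "measure ?P (U t) = G t" for t
    by (simp add: measure_def)
  define Z where "Z = {h \<in> space ?P. \<forall>t. h (\<pi> t) \<in> X}"
  have Z_eq: "Z = (\<Inter>t. U t)" by (auto simp: Z_def U_def)
  have Z_meas: "Z \<in> sets ?P" unfolding Z_eq using U_meas by auto
  have "measure ?P Z \<le> G t" for t
    unfolding U_measure[symmetric] by (rule finite_measure_mono[OF _ U_meas]) (auto simp: Z_eq)
  then have "measure ?P Z \<le> 0"
    using lim unfolding G_def by (intro LIMSEQ_le_const) auto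
  then have "emeasure ?P Z = 0"
    by (simp add: emeasure_eq_measure measure_le_0_iff)
  then show ex: "AE h in ?P. \<exists>t. h (\<pi> t) \<notin> X"
    by (intro AE_I[of _ _ Z]) (auto simp: Z_def Z_meas[unfolded Z_def])
  have D_measure: "emeasure ?P (U t - U (Suc t)) = ennreal (G t - G (Suc t))" for t
  proof -
    have "U (Suc t) \<subseteq> U t" by (auto simp: U_def)
    then show ?thesis
      by (simp add: emeasure_eq_measure finite_measure_Diff U_meas U_measure)
  qed
  have D_nonneg: "0 \<le> G t - G (Suc t)" for t
  proof -
    have "G (Suc t) \<le> G t * 1"
      unfolding G_def prod.lessThan_Suc using G_nonneg[of t]
      by (intro mult_left_mono) (auto simp: G_def F[symmetric] M.prob_le_1)
    then show ?thesis by simp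
  qed
  have "(\<integral>\<^sup>+h. ennreal (w (LEAST t. h (\<pi> t) \<notin> X)) \<partial>?P)
      = (\<integral>\<^sup>+h. (\<Sum>t. ennreal (w t) * indicator (U t - U (Suc t)) h) \<partial>?P)"
  proof (rule nn_integral_cong_AE)
    show "AE h in ?P. ennreal (w (LEAST t. h (\<pi> t) \<notin> X))
        = (\<Sum>t. ennreal (w t) * indicator (U t - U (Suc t)) h)"
      using ex AE_space
    proof eventually_elim
      case (elim h)
      define T where "T = (LEAST t. h (\<pi> t) \<notin> X)"
      have T: "h (\<pi> T) \<notin> X" unfolding T_def using elim(1) by (rule LeastI_ex)
      have T_least: "h (\<pi> s) \<in> X" if "s < T" for s
        using not_less_Least[of s] that unfolding T_def by blast
      have iff: "h \<in> U t - U (Suc t) \<longleftrightarrow> t = T" for t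
      proof
        assume "h \<in> U t - U (Suc t)"
        then have 1: "\<forall>s<t. h (\<pi> s) \<in> X" and "\<not> (\<forall>s<Suc t. h (\<pi> s) \<in> X)"
          using elim(2) by (auto simp: U_def)
        then have "h (\<pi> t) \<notin> X" by (metis less_Suc_eq)
        then show "t = T" using 1 T T_least by (metis linorder_neqE_nat)
      next
        assume "t = T"
        then show "h \<in> U t - U (Suc t)" using T T_least elim(2) unfolding U_def by blast
      qed
      have "ennreal (w t) * indicator (U t - U (Suc t)) h = (if t = T then ennreal (w t) else 0)" for t
        unfolding indicator_def iff by simp
      then have "(\<Sum>t. ennreal (w t) * indicator (U t - U (Suc t)) h)
          = (\<Sum>t. if t = T then ennreal (w t) else 0)"
        by presburger
      also have "\<dots> = ennreal (w T)"
        by (rule sums_unique[symmetric]) (rule sums_single)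
      finally show ?case unfolding T_def by simp
    qed
  qed
  also have "\<dots> = (\<Sum>t. ennreal (w t) * ennreal (G t - G (Suc t)))"
    using U_meas by (subst nn_integral_suminf) (auto simp: nn_integral_cmult D_measure)
  also have "\<dots> = (\<Sum>t. ennreal ((\<Prod>s<t. F s) * (1 - F t) * w t))"
    using D_nonneg w
    by (intro suminf_cong) (simp add: ennreal_mult[symmetric] G_def algebra_simps)
  also have "\<dots> = ennreal S"
  proof (rule suminf_ennreal_eq[OF _ S])
    show "0 \<le> (\<Prod>s<t. F s) * (1 - F t) * w t" for t
      using mult_nonneg_nonneg[OF D_nonneg[of t] w[of t]] by (simp add: G_def algebra_simps)
  qed
  finally show "(\<integral>\<^sup>+h. ennreal (w (LEAST t. h (\<pi> t) \<notin> X)) \<partial>?P) = ennreal S" .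
qed

section \<open>The potential of a level\<close>

lemma ln_le_two_sqrt: "0 < x \<Longrightarrow> ln x \<le> 2 * sqrt x" for x :: real
  using ln_le_minus_one[of "sqrt x"] by (simp add: ln_sqrt)

text \<open>Telescoping: from \<open>1 = (s - r) * (s + r)\<close> each new term
  \<open>1 / s\<close> is at most \<open>2 * (s - r)\<close>.\<close>

lemma sum_inverse_sqrt_le: "(\<Sum>b=1..n. 1 / sqrt (real b)) \<le> 2 * sqrt (real n)"
proof (induction n)
  case (Suc n)
  define s where "s = sqrt (real (Suc n))"
  define r where "r = sqrt (real n)"
  have s: "0 < s" "s\<^sup>2 = real n + 1" "r\<^sup>2 = real n" "0 \<le> r" "r \<le> s"
    by (auto simp: s_def r_def)
  have "1 = (s - r) * (s + r)" using s by (simp add: algebra_simps power2_eq_square)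
  also have "\<dots> \<le> (s - r) * (2 * s)" using s by (intro mult_left_mono) auto
  finally have "1 / s \<le> 2 * s - 2 * r" using s by (simp add: field_simps)
  then show ?case using Suc by (simp add: s_def r_def)
qed simp

lemma sum_inverse_le_ln:
  assumes "1 \<le> a" "a \<le> n"
  shows "(\<Sum>b=a..n. 1 / real b) \<le> 1 + ln (real n / real a)"
  using assms(2)
proof (induction n rule: dec_induct)
  case base
  then show ?case using assms(1) by simp
next
  case (step m)
  have "ln (real m / real (Suc m)) \<le> real m / real (Suc m) - 1"
    using assms step by (intro ln_le_minus_one) auto
  then have "1 / real (Suc m) \<le> ln (real (Suc m)) - ln (real m)"
    using assms step by (simp add: ln_div field_simps)
  then have "1 / real (Suc m) + ln (real m / real a) \<le> ln (real (Suc m) / real a)"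
    using assms step by (simp add: ln_div)
  then show ?case using step by simp
qed

section \<open>One level and its exponential potential\<close>

locale level =
  fixes N p :: nat
  assumes N: "16384 \<le> N" and p: "1 \<le> p"
begin

text \<open>The number of free slots with which a level is closed, a share
  \<open>\<delta> / 4\<close> for \<open>\<delta> = 1 / 2 ^ p\<close>. All levels together then lose
  only a quarter of the slack \<open>\<delta> * n\<close>.\<close>

definition spare :: nat where "spare = N div (4 * 2 ^ p)"
definition quota :: nat where "quota = N - spare"
definition reserve :: nat where "reserve = N div 8"
definition attempts :: "nat \<Rightarrow> nat" where
  "attempts x = 2048 * min (nat \<lceil>sqrt (real N / real (N - x))\<rceil>) p"

text \<open>Bounds \<open>N / b\<close> as long as more than \<open>spare\<close> slots are free,
  hence the mean number of fallback probes in the level.\<close>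

definition M :: real where "M = min (real N) (4 * 2 ^ p)"
text \<open>Small enough for \<open>4 * rate * excess b\<close> to stay below 1, where the
  exponential can be linearised, and large enough for the small starting value in
  \<open>pot_initial\<close>.\<close>

definition rate :: real where "rate = min 1 (512 / (sqrt M + M / real p))"
text \<open>Bounds the odds of overflowing against staying when \<open>b\<close> slots are free,
  that is, the mean number of overflows before the next key stays. The two summands belong to the
  two cases of the minimum in \<open>attempts\<close>.\<close>

definition excess :: "nat \<Rightarrow> real" where
  "excess b = (sqrt (real N / real b) + real N / (real b * real p)) / 2048"
definition total_excess :: "nat \<Rightarrow> real" where
  "total_excess x = (\<Sum>b\<in>{spare<..N - x}. excess b)"
text \<open>Compares the overflows so far, plus a generous allowance for the future ones, with
  \<open>reserve\<close>. The factor \<open>M\<close> is the price of the fallback, so the mean of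
  \<open>pot\<close> dominates the mean cost of exhausting the reserve.\<close>

definition pot :: "nat \<Rightarrow> nat \<Rightarrow> real" where
  "pot x y = M * exp (rate * (real y + 4 * total_excess x - real reserve))"

lemma M_ge: "8 \<le> M"
proof -
  have "(2::real) ^ 1 \<le> 2 ^ p" using p by (intro power_increasing) auto
  then show ?thesis using N by (simp add: M_def)
qed

lemma div_le_M:
  assumes "spare < b" shows "real N / real b \<le> M"
proof -
  have "N < b * (4 * 2 ^ p)"
    using assms unfolding spare_def by (subst (asm) div_less_iff_less_mult) auto
  then have "real N < real (b * (4 * 2 ^ p))" by (simp only: of_nat_less_iff)
  then have "real N \<le> real b * (4 * 2 ^ p)" by simp
  moreover have "real N \<le> real b * real N"
    using assms by (simp add: mult_le_cancel_right1 flip: of_nat_mult)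
  ultimately show ?thesis using assms by (simp add: M_def field_simps)
qed

lemma ln_M_le: "ln M \<le> 3 * real p"
proof -
  have "ln M \<le> ln (2 ^ (p + 2))"
    using M_ge by (subst ln_le_cancel_iff) (auto simp: M_def power_add)
  also have "\<dots> = real (p + 2) * ln 2" by (subst ln_realpow) auto
  also have "\<dots> \<le> real (p + 2) * 1" using ln_le_minus_one[of 2] by (intro mult_left_mono) auto
  also have "\<dots> \<le> 3 * real p" using p by simp
  finally show ?thesis .
qed

lemma excess_nonneg: "0 \<le> excess b"
  by (simp add: excess_def)

lemma spare_less: "spare < N"
proof -
  have "(1::nat) \<le> 2 ^ p" by simp
  then have "1 < 4 * (2::nat) ^ p" by linarith
  then show ?thesis using N unfolding spare_def by (intro div_less_dividend) auto
qed

lemma rate_pos: "0 < rate" and rate_le_1: "rate \<le> 1"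
  using M_ge by (auto simp: rate_def intro!: divide_pos_pos add_pos_nonneg)

text \<open>Both summands of \<open>excess\<close> increase with \<open>N / b\<close>, which is at
  most \<open>M\<close>; the quotient 512 / 2048 of the constants supplies the factor 1/4.\<close>

lemma rate_excess:
  assumes "spare < b" shows "4 * (rate * excess b) \<le> 1"
proof -
  define K where "K = sqrt M + M / real p"
  have K: "0 < K" using M_ge by (auto simp: K_def intro!: add_pos_nonneg)
  have "real N / (real b * real p) \<le> M / real p"
    using divide_right_mono[OF div_le_M[OF assms], of "real p"] by simp
  then have "excess b \<le> K / 2048"
    unfolding excess_def K_def using div_le_M[OF assms]
    by (intro divide_right_mono add_mono real_sqrt_le_mono) auto
  then have "rate * excess b \<le> (512 / K) * (K / 2048)"
    using K excess_nonneg by (intro mult_mono) (auto simp: rate_def K_def)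
  then show ?thesis using K by simp
qed

text \<open>The square roots sum to at most \<open>2 * N\<close>. The harmonic sum is of order
  \<open>ln M\<close>, hence of order \<open>p\<close>, and the divisor \<open>p\<close> in
  \<open>excess\<close> absorbs it, leaving \<open>4 * N\<close>.\<close>

lemma total_excess_0_le: "total_excess 0 \<le> 6 * real N / 2048"
proof -
  have "(\<Sum>b\<in>{spare<..N}. sqrt (real N / real b)) = sqrt (real N) * (\<Sum>b\<in>{spare<..N}. 1 / sqrt (real b))"
    by (simp add: real_sqrt_divide sum_distrib_left)
  also have "\<dots> \<le> sqrt (real N) * (\<Sum>b=1..N. 1 / sqrt (real b))"
    by (intro mult_left_mono sum_mono2) auto
  also have "\<dots> \<le> sqrt (real N) * (2 * sqrt (real N))"
    by (intro mult_left_mono sum_inverse_sqrt_le) auto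
  finally have 1: "(\<Sum>b\<in>{spare<..N}. sqrt (real N / real b)) \<le> 2 * real N"
    by (simp only: mult.left_commute[of _ 2] real_sqrt_mult_self abs_of_nat)
  have "(\<Sum>b\<in>{spare<..N}. 1 / real b) \<le> 1 + ln (real N / real (Suc spare))"
    using sum_inverse_le_ln[of "Suc spare" N] spare_less by (simp add: atLeastSucAtMost_greaterThanAtMost)
  also have "\<dots> \<le> 1 + ln M"
    using div_le_M[of "Suc spare"] N M_ge by (auto intro!: ln_mono divide_pos_pos)
  also have "\<dots> \<le> 4 * real p" using ln_M_le p by simp
  finally have "(real N / real p) * (\<Sum>b\<in>{spare<..N}. 1 / real b) \<le> (real N / real p) * (4 * real p)"
    by (intro mult_left_mono) auto
  then have 2: "(\<Sum>b\<in>{spare<..N}. real N / (real b * real p)) \<le> 4 * real N"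
    using p by (simp add: sum_distrib_left mult.commute)
  have "total_excess 0 = ((\<Sum>b\<in>{spare<..N}. sqrt (real N / real b))
      + (\<Sum>b\<in>{spare<..N}. real N / (real b * real p))) / 2048"
    by (simp add: total_excess_def excess_def sum.distrib flip: sum_divide_distrib)
  with 1 2 show ?thesis by simp
qed

lemma total_excess_le: "total_excess x \<le> total_excess 0"
  unfolding total_excess_def by (intro sum_mono2) (auto simp: excess_nonneg)

lemma total_excess_Suc:
  assumes "spare < N - x"
  shows "total_excess x = total_excess (Suc x) + excess (N - x)"
proof -
  have "{spare<..N - x} = insert (N - x) {spare<..N - Suc x}" using assms by auto
  moreover have "N - x \<notin> {spare<..N - Suc x}" using assms by auto
  ultimately show ?thesis by (simp add: total_excess_def)
qed

lemma pot_nonneg: "0 \<le> pot x y"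
  using M_ge by (simp add: pot_def)

text \<open>\<open>reserve\<close> exceeds the allowance \<open>4 * total_excess x\<close> by at
  least \<open>N / 32\<close>, and \<open>rate * N / 32\<close> is at least \<open>2 * ln M\<close>,
  so the exponential is at most \<open>1 / (M * M)\<close>. The load \<open>x\<close> is arbitrary
  because a level may start with keys that overflowed into it.\<close>

lemma pot_initial: "pot x 0 \<le> 1 / M"
proof -
  have N': "real N / 16 \<le> real reserve" using N unfolding reserve_def by linarith
  have "2 * ln M \<le> rate * (real N / 32)"
  proof (cases "rate = 1")
    case True
    \<comment> \<open>The lower bound 16384 on \<open>N\<close> is the square of 128; it turns
      \<open>4 * sqrt N\<close> into at most \<open>N / 32\<close>.\<close>
    have "128\<^sup>2 \<le> real N" using N by simp
    then have s: "128 \<le> sqrt (real N)" by (rule real_le_rsqrt)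
    have "ln M \<le> ln (real N)" using M_ge N by (simp add: M_def)
    also have "\<dots> \<le> 2 * sqrt (real N)" using N by (intro ln_le_two_sqrt) auto
    finally have "2 * ln M \<le> 128 * sqrt (real N) / 32" by simp
    also have "\<dots> \<le> sqrt (real N) * sqrt (real N) / 32"
      using s by (intro divide_right_mono mult_right_mono) auto
    finally show ?thesis using True by simp
  next
    case False
    define K where "K = sqrt M + M / real p"
    have K: "0 < K" using M_ge by (auto simp: K_def intro!: add_pos_nonneg)
    have rate: "rate = 512 / K" using False by (auto simp: rate_def K_def min_def split: if_splits)
    \<comment> \<open>The summands of \<open>K\<close> call for different bounds on
      \<open>ln M\<close>: \<open>2 * sqrt M\<close> against \<open>sqrt M\<close>, and
      \<open>3 * p\<close> against \<open>M / p\<close>. Each product is of order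
      \<open>M\<close>.\<close>
    have "ln M * sqrt M \<le> (2 * sqrt M) * sqrt M"
      using M_ge by (intro mult_right_mono ln_le_two_sqrt) auto
    moreover have "ln M * (M / real p) \<le> (3 * real p) * (M / real p)"
      using M_ge by (intro mult_right_mono ln_M_le) auto
    ultimately have "ln M * K \<le> 8 * M"
      using M_ge p by (simp add: K_def algebra_simps)
    also have "\<dots> \<le> 8 * real N" by (simp add: M_def)
    finally show ?thesis using K by (simp add: rate field_simps)
  qed
  also have "real N / 32 \<le> real reserve - 4 * total_excess x"
    using N' total_excess_0_le total_excess_le[of x] by linarith
  then have "rate * (real N / 32) \<le> rate * (real reserve - 4 * total_excess x)"
    using rate_pos by (intro mult_left_mono) auto
  finally have "exp (rate * (real 0 + 4 * total_excess x - real reserve)) \<le> exp (- (2 * ln M))"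
    by (simp add: algebra_simps)
  also have "\<dots> = 1 / (M * M)"
  proof -
    have "exp (2 * ln M) = M * M"
      using M_ge by (simp only: mult_2 exp_add) simp
    then show ?thesis by (simp only: exp_minus inverse_eq_divide)
  qed
  finally have "pot x 0 \<le> M * (1 / (M * M))"
    unfolding pot_def using M_ge by (intro mult_left_mono) auto
  then show ?thesis using M_ge by simp
qed

text \<open>Once the reserve is exhausted, the potential pays for the worst mean number of fallback
  probes.\<close>

lemma pot_ge_M:
  assumes "reserve \<le> y" shows "M \<le> pot x y"
proof -
  have "0 \<le> total_excess x"
    unfolding total_excess_def by (intro sum_nonneg excess_nonneg)
  then have "1 \<le> exp (rate * (real y + 4 * total_excess x - real reserve))"
    using assms rate_pos by simp
  then show ?thesis using M_ge by (simp add: pot_def mult_le_cancel_left1)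
qed

lemma pot_Suc_y: "pot x (Suc y) = exp rate * pot x y"
  by (simp add: pot_def algebra_simps exp_add[symmetric])

lemma pot_Suc_x:
  assumes "spare < N - x"
  shows "pot (Suc x) y = exp (- (4 * (rate * excess (N - x)))) * pot x y"
  using total_excess_Suc[OF assms] by (simp add: pot_def algebra_simps exp_add[symmetric])

lemma pot_Suc_x_le:
  assumes "spare < N - x"
  shows "pot (Suc x) y \<le> pot x y"
  using pot_nonneg[of x y] rate_pos excess_nonneg
  by (simp add: pot_Suc_x[OF assms] mult_left_le_one_le)

lemma attempts_le: "attempts x \<le> 2048 * p"
  by (simp add: attempts_def)

text \<open>Each attempt succeeds with probability at most the free share and has then used at most
  \<open>attempts x\<close> samples; the product bounded here controls the mean cost of all attempts
  together.\<close>

lemma attempts_square_le: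
  assumes "x < N"
  shows "real (N - x) / real N * (real (attempts x))\<^sup>2 \<le> 4096\<^sup>2"
proof -
  let ?s = "sqrt (real N / real (N - x))"
  have s: "1 \<le> ?s" using assms by simp
  have "real (nat \<lceil>?s\<rceil>) \<le> 2 * ?s" using s by linarith
  then have "real (attempts x) \<le> 4096 * ?s" by (simp add: attempts_def min_def)
  then have "(real (attempts x))\<^sup>2 \<le> (4096 * ?s)\<^sup>2" by (intro power_mono) auto
  also have "\<dots> = 4096\<^sup>2 * (real N / real (N - x))" by (simp add: power_mult_distrib)
  finally have "real (N - x) / real N * (real (attempts x))\<^sup>2
      \<le> real (N - x) / real N * (4096\<^sup>2 * (real N / real (N - x)))"
    by (intro mult_left_mono) auto
  also have "\<dots> = 4096\<^sup>2" using assms by (simp del: of_nat_diff)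
  finally show ?thesis .
qed

text \<open>\<open>\<rho>\<close> is the probability that all attempts fail. Bernoulli's inequality
  and \<open>(1 - \<epsilon>) * (1 + \<epsilon>) \<le> 1\<close> give
  \<open>\<rho> * f * \<epsilon> \<le> 1 - \<rho>\<close>, and
  \<open>f * \<epsilon> * excess (N - x)\<close> is at least 1.\<close>

lemma overflow_le_excess:
  assumes "x < N"
  defines "\<rho> \<equiv> (real x / real N) ^ attempts x"
  shows "0 \<le> \<rho>" "\<rho> \<le> 1" "\<rho> \<le> excess (N - x) * (1 - \<rho>)"
proof -
  define a where "a = real (N - x)"
  define \<epsilon> where "\<epsilon> = a / real N"
  define f where "f = attempts x"
  have a: "1 \<le> a" using assms by (simp add: a_def)
  have \<epsilon>: "0 < \<epsilon>" "\<epsilon> \<le> 1" using assms by (auto simp: \<epsilon>_def a_def)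
  have \<rho>: "\<rho> = (1 - \<epsilon>) ^ f"
    using assms by (simp add: \<rho>_def \<epsilon>_def a_def f_def of_nat_diff field_simps)
  show "0 \<le> \<rho>" "\<rho> \<le> 1" using \<epsilon> by (auto simp: \<rho> power_le_one)
  have "\<rho> * (1 + real f * \<epsilon>) \<le> \<rho> * (1 + \<epsilon>) ^ f"
    using \<open>0 \<le> \<rho>\<close> \<epsilon> by (intro mult_left_mono Bernoulli_inequality) auto
  also have "\<dots> = (1 - \<epsilon>\<^sup>2) ^ f"
    by (simp add: \<rho> power_mult_distrib[symmetric] algebra_simps power2_eq_square)
  also have "\<dots> \<le> 1" using \<epsilon> by (intro power_le_one) (auto simp: power_le_one)
  finally have *: "\<rho> * (real f * \<epsilon>) \<le> 1 - \<rho>" by (simp add: algebra_simps)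
  have ex: "excess (N - x) = (sqrt (1 / \<epsilon>) + 1 / (\<epsilon> * real p)) / 2048"
    by (simp add: excess_def \<epsilon>_def a_def)
  \<comment> \<open>The factor 2048 in \<open>attempts\<close> cancels the divisor in
    \<open>excess\<close>; each case of the minimum keeps the matching summand and drops the
    other.\<close>
  have "1 \<le> real f * \<epsilon> * excess (N - x)"
  proof (cases "nat \<lceil>sqrt (1 / \<epsilon>)\<rceil> \<le> p")
    case True
    then have "2048 * sqrt (1 / \<epsilon>) \<le> real f"
      by (simp add: f_def attempts_def \<epsilon>_def a_def min_def)
    then have "(2048 * sqrt (1 / \<epsilon>)) * \<epsilon> * (sqrt (1 / \<epsilon>) / 2048) \<le> real f * \<epsilon> * excess (N - x)"
      using \<epsilon> by (intro mult_mono) (auto simp: ex)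
    then show ?thesis using \<epsilon> by (simp add: field_simps)
  next
    case False
    then have "min (nat \<lceil>sqrt (real N / real (N - x))\<rceil>) p = p"
      by (simp add: \<epsilon>_def a_def del: of_nat_diff nat_ceiling_le_eq)
    then have "real f = 2048 * real p"
      by (simp add: f_def attempts_def del: of_nat_diff)
    then have "2048 * real p * \<epsilon> * (1 / (\<epsilon> * real p) / 2048) \<le> real f * \<epsilon> * excess (N - x)"
      using \<epsilon> by (intro mult_mono) (auto simp: ex)
    then show ?thesis using \<epsilon> p by simp
  qed
  then have "\<rho> * 1 \<le> \<rho> * (real f * \<epsilon> * excess (N - x))"
    using \<open>0 \<le> \<rho>\<close> by (intro mult_left_mono)
  also have "\<dots> \<le> (1 - \<rho>) * excess (N - x)"
    using mult_right_mono[OF * excess_nonneg[of "N - x"]] by (simp add: algebra_simps)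
  finally show "\<rho> \<le> excess (N - x) * (1 - \<rho>)" by (simp add: mult.commute)
qed

text \<open>An overflow multiplies the potential by at most \<open>1 + 2 * rate\<close>, a key that
  stays by at most \<open>1 - 2 * e\<close>. The bound on the odds, in the form
  \<open>rate * \<rho> \<le> e * (1 - \<rho>)\<close>, balances the two.\<close>

lemma pot_supermartingale:
  assumes x: "spare < N - x"
  defines "\<rho> \<equiv> (real x / real N) ^ attempts x"
  shows "\<rho> * pot x (Suc y) + (1 - \<rho>) * pot (Suc x) y \<le> pot x y"
proof -
  define e where "e = rate * excess (N - x)"
  have e: "0 \<le> e" "4 * e \<le> 1"
    using rate_pos excess_nonneg rate_excess[OF x] by (auto simp: e_def)
  have \<rho>: "0 \<le> \<rho>" "\<rho> \<le> 1" "\<rho> \<le> excess (N - x) * (1 - \<rho>)"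
    using overflow_le_excess[of x] x by (auto simp: \<rho>_def)
  have "exp rate \<le> 1 + rate + rate * rate"
    using exp_bound[of rate] rate_pos rate_le_1 by (simp add: power2_eq_square)
  moreover have "rate * rate \<le> rate" using rate_pos rate_le_1 by (intro mult_left_le) auto
  ultimately have 1: "exp rate \<le> 1 + 2 * rate" by simp
  have 2: "exp (- (4 * e)) \<le> 1 - 2 * e"
  proof -
    have "1 \<le> (1 - 2 * e) * (1 + 4 * e)"
    proof -
      have "e * (4 * e) \<le> e * 1" using e by (intro mult_left_mono) auto
      then show ?thesis by (simp add: algebra_simps)
    qed
    also have "\<dots> \<le> (1 - 2 * e) * exp (4 * e)"
      using e by (intro mult_left_mono exp_ge_add_one_self) auto
    finally show ?thesis by (simp add: exp_minus field_simps)
  qed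
  have "rate * \<rho> \<le> rate * (excess (N - x) * (1 - \<rho>))"
    using \<rho> rate_pos by (intro mult_left_mono) auto
  then have 3: "rate * \<rho> \<le> e * (1 - \<rho>)" by (simp add: e_def)
  have "\<rho> * exp rate + (1 - \<rho>) * exp (- (4 * e)) \<le> \<rho> * (1 + 2 * rate) + (1 - \<rho>) * (1 - 2 * e)"
    using 1 2 \<rho> by (intro add_mono mult_left_mono) auto
  also have "\<dots> \<le> 1" using 3 by (simp add: algebra_simps)
  finally have "(\<rho> * exp rate + (1 - \<rho>) * exp (- (4 * e))) * pot x y \<le> 1 * pot x y"
    by (intro mult_right_mono pot_nonneg)
  then show ?thesis
    by (simp add: pot_Suc_y pot_Suc_x[OF x] e_def algebra_simps)
qed

end

section \<open>Elastic hashing\<close>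

text \<open>Uniqueness of the splitting into a power of two and an odd factor; it keeps the even
  probe positions of different levels apart.\<close>

lemma two_power_odd_inject:
  "2 ^ a * (2 * u + 1) = 2 ^ b * (2 * v + 1) \<Longrightarrow> a = b \<and> u = v" for u v :: nat
proof (induction a arbitrary: b)
  case 0
  show ?case
  proof (cases b)
    case (Suc b')
    with 0 have "2 * u + 1 = 2 * (2 ^ b' * (2 * v + 1))" by simp
    then show ?thesis by presburger
  qed (use 0 in simp)
next
  case (Suc a)
  show ?case
  proof (cases b)
    case 0
    with Suc.prems have "2 * (2 ^ a * (2 * u + 1)) = 2 * v + 1" by simp
    then show ?thesis by presburger
  next
    case (Suc b')
    with Suc.prems have "2 * (2 ^ a * (2 * u + 1)) = 2 * (2 ^ b' * (2 * v + 1))"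
      by (simp only: power_Suc mult.assoc)
    then have "2 ^ a * (2 * u + 1) = 2 ^ b' * (2 * v + 1)" by simp
    from Suc.IH[OF this] Suc show ?thesis by simp
  qed
qed

section \<open>Encoding phases as bounded numbers\<close>

lemma prod_encode_le: "prod_encode (a, b) \<le> (a + b + 1)\<^sup>2"
proof -
  have "triangle k \<le> k * k" for k by (induction k) auto
  from this[of "a + b"] show ?thesis
    by (simp add: prod_encode_def power2_eq_square)
qed

text \<open>
  The memory \<open>(i, x, y)\<close> holds the level \<open>i\<close> being filled and the loads \<open>x\<close> and \<open>y\<close> of levels \<open>i\<close> and \<open>i + 1\<close>.
\<close>

type_synonym phase = "nat \<times> nat \<times> nat"

definition enc :: "phase \<Rightarrow> nat" where
  "enc s = (case s of (i, x, y) \<Rightarrow> prod_encode (i, prod_encode (x, y)))"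

definition dec :: "nat \<Rightarrow> phase" where
  "dec c = (case prod_decode c of (i, z) \<Rightarrow> (i, prod_decode z))"

lemma dec_enc [simp]: "dec (enc s) = s"
  by (auto simp: dec_def enc_def split: prod.splits)

lemma enc_dec [simp]: "enc (dec c) = c"
  by (simp add: enc_def dec_def split: prod.splits) (metis prod_decode_inverse)

lemma dec_0 [simp]: "dec 0 = (0, 0, 0)"
  using dec_enc[of "(0, 0, 0)"] by (simp add: enc_def prod_encode_def)

text \<open>The pairing function is quadratic, so two nested pairings have degree four;
  \<open>16 \<le> n\<close> absorbs the constants into a power of \<open>n\<close>.\<close>

lemma enc_less:
  assumes "i \<le> n" "x \<le> n" "y \<le> n" "16 \<le> n"
  shows "enc (i, x, y) < n ^ 8"
proof -
  have "(x + y + 1)\<^sup>2 \<le> (3 * n)\<^sup>2" using assms by (intro power_mono) auto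
  then have "prod_encode (x, y) \<le> 9 * n\<^sup>2"
    using prod_encode_le[of x y] by (simp add: power_mult_distrib)
  then have "i + prod_encode (x, y) + 1 \<le> 16 * n\<^sup>2"
  proof -
    have "n \<le> n\<^sup>2" using assms by (simp add: power2_eq_square)
    then show ?thesis using \<open>prod_encode (x, y) \<le> 9 * n\<^sup>2\<close> assms by linarith
  qed
  then have "(i + prod_encode (x, y) + 1)\<^sup>2 \<le> (16 * n\<^sup>2)\<^sup>2" by (rule power_mono) simp
  also have "\<dots> \<le> (n * n\<^sup>2)\<^sup>2" using assms by (intro power_mono mult_right_mono) auto
  also have "\<dots> = n ^ 6 * 1" by (simp add: power2_eq_square eval_nat_numeral)
  also have "\<dots> < n ^ 6 * n\<^sup>2" using assms less_1_mult[of n n]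
    by (intro mult_strict_left_mono) (auto simp: power2_eq_square)
  also have "\<dots> = n ^ 8" by (simp flip: power_add)
  finally show ?thesis
    using prod_encode_le[of i "prod_encode (x, y)"] by (simp add: enc_def)
qed

section \<open>Geometric series with two failure rates\<close>

text \<open>The first \<open>c\<close> samples fail with probability \<open>\<alpha>\<close>, all
  later ones with \<open>\<beta>\<close>. The series splits at \<open>c\<close>; \<open>S\<close> is
  the shifted geometric sum of the second stage.\<close>

lemma two_phase_sums:
  fixes \<alpha> \<beta> :: real and w :: "nat \<Rightarrow> real"
  assumes S: "(\<lambda>j. \<beta> ^ j * w (j + c)) sums S"
  defines "F \<equiv> \<lambda>t. if t < c then \<alpha> else \<beta>"
  shows "(\<lambda>t. (\<Prod>s<t. F s) * (1 - F t) * w t) sums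
    ((\<Sum>t<c. \<alpha> ^ t * (1 - \<alpha>) * w t) + \<alpha> ^ c * (1 - \<beta>) * S)"
proof -
  have G1: "(\<Prod>s<t. F s) = \<alpha> ^ t" if "t \<le> c" for t
    using that by (induction t) (auto simp: F_def)
  have G2: "(\<Prod>s<j + c. F s) = \<alpha> ^ c * \<beta> ^ j" for j
    by (induction j) (auto simp: G1 F_def)
  have "(\<lambda>j. (\<alpha> ^ c * (1 - \<beta>)) * (\<beta> ^ j * w (j + c))) sums (\<alpha> ^ c * (1 - \<beta>) * S)"
    by (rule sums_mult[OF S])
  moreover have "(\<Prod>s<j + c. F s) * (1 - F (j + c)) * w (j + c)
      = (\<alpha> ^ c * (1 - \<beta>)) * (\<beta> ^ j * w (j + c))" for j
    by (subst G2) (simp add: F_def)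
  ultimately have "(\<lambda>j. (\<Prod>s<j + c. F s) * (1 - F (j + c)) * w (j + c)) sums (\<alpha> ^ c * (1 - \<beta>) * S)"
    by (simp only:)
  then have "(\<lambda>t. (\<Prod>s<t. F s) * (1 - F t) * w t) sums
      (\<alpha> ^ c * (1 - \<beta>) * S + (\<Sum>t<c. (\<Prod>s<t. F s) * (1 - F t) * w t))"
    by (subst (asm) sums_iff_shift)
  moreover have "(\<Sum>t<c. (\<Prod>s<t. F s) * (1 - F t) * w t) = (\<Sum>t<c. \<alpha> ^ t * (1 - \<alpha>) * w t)"
    by (intro sum.cong) (auto simp: G1 F_def)
  ultimately show ?thesis by (simp add: add.commute)
qed

lemma two_phase_lim:
  fixes \<alpha> \<beta> :: real
  assumes "0 \<le> \<beta>" "\<beta> < 1"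
  shows "(\<lambda>t. \<Prod>s<t. if s < c then \<alpha> else \<beta>) \<longlonglongrightarrow> 0"
proof -
  have G1: "(\<Prod>s<t. if s < c then \<alpha> else \<beta>) = \<alpha> ^ t" if "t \<le> c" for t
    using that by (induction t) auto
  have "(\<Prod>s<j + c. if s < c then \<alpha> else \<beta>) = \<alpha> ^ c * \<beta> ^ j" for j
    by (induction j) (auto simp: G1)
  moreover have "(\<lambda>j. \<alpha> ^ c * \<beta> ^ j) \<longlonglongrightarrow> \<alpha> ^ c * 0"
    using assms by (intro tendsto_intros LIMSEQ_power_zero) auto
  ultimately have "(\<lambda>j. \<Prod>s<j + c. if s < c then \<alpha> else \<beta>) \<longlonglongrightarrow> 0" by simp
  then show ?thesis by (rule LIMSEQ_offset)
qed

lemma geometric_mean_sums: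
  fixes \<beta> :: real
  assumes "0 \<le> \<beta>" "\<beta> < 1"
  shows "(\<lambda>j. \<beta> ^ j * real (j + 1)) sums (1 / (1 - \<beta>)\<^sup>2)"
  using geometric_deriv_sums[of \<beta>] assms by (simp add: mult.commute)

lemma sum_geometric_telescope: "(\<Sum>t<c. \<alpha> ^ t * (1 - \<alpha>) * (A::real)) = (1 - \<alpha> ^ c) * A"
  by (induction c) (auto simp: algebra_simps)

section \<open>Sizes and positions of the levels\<close>

locale elastic =
  fixes n p :: nat
  assumes p: "1 \<le> p" and n: "65536 * 2 ^ p \<le> n"
begin

text \<open>The last level \<open>p\<close> reaches down to slot 1, so that the levels
  \<open>0\<close> to \<open>p\<close> cover the whole array.\<close>

definition lo :: "nat \<Rightarrow> nat" where "lo i = (if i < p then n div 2 ^ Suc i else 0)"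
definition slots :: "nat \<Rightarrow> nat set" where "slots i = {lo i<..n div 2 ^ i}"
definition N :: "nat \<Rightarrow> nat" where "N i = n div 2 ^ i - lo i"

lemma n_ge: "65536 \<le> n"
proof -
  have "(1::nat) \<le> 2 ^ p" by simp
  with n show ?thesis by linarith
qed

lemma p_le_n: "p \<le> n"
  using n less_exp[of p] by linarith

lemma card_slots: "card (slots i) = N i"
  by (simp add: slots_def N_def)

lemma finite_slots [simp]: "finite (slots i)"
  by (simp add: slots_def)

lemma slots_subset: "slots i \<subseteq> {1..n}"
  unfolding slots_def by (auto intro: le_trans[OF _ div_le_dividend])

lemma n_div_ge: "i \<le> p \<Longrightarrow> 65536 \<le> n div 2 ^ i"
proof -
  assume "i \<le> p"
  then have "(2::nat) ^ i \<le> 2 ^ p" by (intro power_increasing) auto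
  with n have "65536 * 2 ^ i \<le> n" by (meson le_trans mult_le_mono2)
  then show ?thesis by (simp add: less_eq_div_iff_mult_less_eq)
qed

lemma lo_less: "i < p \<Longrightarrow> lo i = n div 2 ^ i div 2"
  by (simp only: lo_def if_True power_Suc2 div_mult2_eq)

lemma N_ge: "i \<le> p \<Longrightarrow> 16384 \<le> N i"
  using n_div_ge[of i] lo_less[of i] by (cases "i < p") (auto simp: N_def lo_def)

text \<open>Level \<open>i\<close> takes about half of the \<open>?r\<close> slots not in earlier
  levels, level \<open>Suc i\<close> at least about a quarter. Overflow capped at
  \<open>N i div 8\<close> therefore fills at most half of level \<open>Suc i\<close>.\<close>

lemma N_Suc: "i < p \<Longrightarrow> 2 * (N i div 8) \<le> N (Suc i)"
proof -
  assume i: "i < p"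
  let ?r = "n div 2 ^ i"
  have r: "n div 2 ^ Suc i = ?r div 2" by (simp only: power_Suc2 div_mult2_eq)
  have "N i = ?r - ?r div 2" using i by (simp add: N_def lo_less)
  moreover have "lo (Suc i) \<le> ?r div 2 div 2"
    unfolding r[symmetric] by (cases "Suc i < p") (simp_all only: lo_less, simp_all add: lo_def)
  then have "?r div 2 - ?r div 2 div 2 \<le> N (Suc i)"
    unfolding N_def r by (rule diff_le_mono2)
  ultimately show ?thesis using n_div_ge[of i] i by linarith
qed

lemma n_le_N: "i < p \<Longrightarrow> n \<le> N i * 2 ^ (i + 2)"
proof -
  assume i: "i < p"
  let ?r = "n div 2 ^ i"
  have "?r \<le> 2 * N i" using i by (simp add: N_def lo_less)
  moreover have "?r + 1 \<le> 2 * ?r" using n_div_ge[of i] i by simp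
  ultimately have "?r + 1 \<le> 4 * N i" by linarith
  then have "(?r + 1) * 2 ^ i \<le> 4 * N i * 2 ^ i" by (rule mult_right_mono) simp
  moreover have "n \<le> (?r + 1) * 2 ^ i"
    using dividend_less_div_times[of "2 ^ i" n] by simp
  ultimately show ?thesis by (simp add: power_add algebra_simps)
qed

lemma N_le: "N i \<le> n"
  unfolding N_def by (rule le_trans[OF diff_le_self div_le_dividend])

lemma slots_disjoint:
  assumes "i < j" "j \<le> p" shows "slots i \<inter> slots j = {}"
proof -
  have "(2::nat) ^ Suc i \<le> 2 ^ j" using assms by (intro power_increasing) auto
  then have "n div 2 ^ j \<le> n div 2 ^ Suc i" by (intro div_le_mono2) auto
  then show ?thesis using assms by (auto simp: slots_def lo_def)
qed

lemma sum_N: "i \<le> p \<Longrightarrow> (\<Sum>j<i. N j) + n div 2 ^ i = n"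
proof (induction i)
  case (Suc i)
  have "n div 2 ^ Suc i \<le> n div 2 ^ i" by (intro div_le_mono2) auto
  with Suc show ?case by (simp add: N_def lo_def)
qed simp

lemma level_N: "i \<le> p \<Longrightarrow> level (N i) p"
  using N_ge p by unfold_locales auto


abbreviation quota_at :: "nat \<Rightarrow> nat" where "quota_at i \<equiv> level.quota (N i) p"
abbreviation reserve_at :: "nat \<Rightarrow> nat" where "reserve_at i \<equiv> level.reserve (N i)"
abbreviation attempts_at :: "nat \<Rightarrow> nat \<Rightarrow> nat" where "attempts_at i \<equiv> level.attempts (N i) p"

lemma reserve_less_quota: "i \<le> p \<Longrightarrow> 2 * reserve_at i < quota_at i"
proof -
  assume "i \<le> p"
  then interpret level "N i" p by (rule level_N)
  have "(2::nat) ^ 1 \<le> 2 ^ p" using p by (intro power_increasing) auto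
  then have "N i div (4 * 2 ^ p) \<le> N i div 8" by (intro div_le_mono2) auto
  then show ?thesis using N unfolding reserve_def quota_def spare_def by linarith
qed

lemma N_le_quota: "i \<le> p \<Longrightarrow> 7 * N i \<le> 8 * quota_at i"
proof -
  assume "i \<le> p"
  then interpret level "N i" p by (rule level_N)
  have "(2::nat) ^ 1 \<le> 2 ^ p" using p by (intro power_increasing) auto
  then have "N i div (4 * 2 ^ p) \<le> N i div 8" by (intro div_le_mono2) auto
  then show ?thesis unfolding quota_def spare_def by linarith
qed

lemma quota_le: "i \<le> p \<Longrightarrow> quota_at i \<le> N i"
  using level.quota_def[OF level_N] by simp

lemma reserve_Suc: "i < p \<Longrightarrow> 2 * reserve_at i \<le> N (Suc i)"
  using N_Suc[of i] level.reserve_def[OF level_N, of i] by simp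

subsection \<open>Probe sequences\<close>

definition weight :: "nat \<Rightarrow> nat" where "weight i = min p (2 ^ (i div 2))"

text \<open>
  \<open>ix i q\<close> is the position in the probe sequence of the \<open>q\<close>-th sample from level \<open>i\<close>.  Low levels use even
  positions and have period of order \<open>2 ^ (i / 2)\<close>, which the \<open>2 ^ (- i)\<close> share of the keys placed there
  makes summable; high levels share the odd positions round-robin, for the worst case \<open>O(p)\<close>.
\<close>

definition ix :: "nat \<Rightarrow> nat \<Rightarrow> nat" where
  "ix i q = (if 2 ^ (i div 2) \<le> p then 2 * (2 ^ (i div 2) * (2 * (2 * q + i mod 2) + 1))
             else 2 * (q * (p + 2) + i) + 1)"

text \<open>The level from which a position is sampled, as an inverse of \<open>ix\<close>. For
  positions outside the range of \<open>ix\<close> the value is arbitrary, and \<open>min p\<close>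
  keeps it a level.\<close>

definition lev :: "nat \<Rightarrow> nat" where
  "lev l = min p (fst (inv_into ({..p} \<times> UNIV) (\<lambda>(i, q). ix i q) l))"

lemma ix_pos: "1 \<le> ix i q"
proof -
  have "0 < ix i q" by (simp add: ix_def)
  then show ?thesis by simp
qed

text \<open>Parity separates low from high levels. On even positions the power of two gives
  \<open>i div 2\<close> and the odd factor gives \<open>q\<close> and \<open>i mod 2\<close>; on
  odd positions \<open>i\<close> is the remainder modulo \<open>p + 2\<close>.\<close>

lemma ix_inject:
  assumes eq: "ix i q = ix j r" and "i \<le> p" "j \<le> p"
  shows "i = j \<and> q = r"
proof -
  have parity: "2 ^ (i div 2) \<le> p \<longleftrightarrow> 2 ^ (j div 2) \<le> p"
  proof -
    have "even (ix i q) \<longleftrightarrow> 2 ^ (i div 2) \<le> p" "even (ix j r) \<longleftrightarrow> 2 ^ (j div 2) \<le> p"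
      by (auto simp: ix_def)
    with eq show ?thesis by simp
  qed
  show ?thesis
  proof (cases "2 ^ (i div 2) \<le> p")
    case True
    with eq parity have "2 ^ (i div 2) * (2 * (2 * q + i mod 2) + 1) = 2 ^ (j div 2) * (2 * (2 * r + j mod 2) + 1)"
      by (simp add: ix_def)
    from two_power_odd_inject[OF this] have 1: "i div 2 = j div 2" "2 * q + i mod 2 = 2 * r + j mod 2"
      by auto
    have 2: "i mod 2 = j mod 2"
      using arg_cong[OF 1(2), of "\<lambda>z. z mod 2"] by simp
    have "i = j" using 1(1) 2 by (metis div_mult_mod_eq)
    then show ?thesis using 1(2) by simp
  next
    case False
    with eq parity have *: "q * (p + 2) + i = r * (p + 2) + j" by (simp add: ix_def)
    have "i = (q * (p + 2) + i) mod (p + 2)" "j = (r * (p + 2) + j) mod (p + 2)"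
      using assms by (simp_all only: mod_mult_self3) simp_all
    with * have "i = j" by simp
    with * have "q * (p + 2) = r * (p + 2)" by linarith
    with \<open>i = j\<close> show ?thesis by (simp only: mult_cancel2) simp
  qed
qed

lemma lev_ix: "i \<le> p \<Longrightarrow> lev (ix i q) = i"
proof -
  assume i: "i \<le> p"
  have "inj_on (\<lambda>(i, q). ix i q) ({..p} \<times> UNIV)"
    by (auto simp: inj_on_def dest: ix_inject)
  from inv_into_f_f[OF this, of "(i, q)"] i show ?thesis by (simp add: lev_def)
qed

lemma ix_le: "i \<le> p \<Longrightarrow> ix i q \<le> 8 * weight i * (q + 1)"
proof (cases "2 ^ (i div 2) \<le> p")
  case True
  have "2 * (2 * q + i mod 2) + 1 \<le> 4 * (q + 1)"
    by (simp add: mod2_eq_if)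
  then have "2 ^ (i div 2) * (2 * (2 * q + i mod 2) + 1) \<le> 2 ^ (i div 2) * (4 * (q + 1))"
    by (rule mult_left_mono) simp
  then show ?thesis using True by (simp add: ix_def weight_def algebra_simps)
next
  case False
  assume "i \<le> p"
  have "q * 1 \<le> q * p" using p by (rule mult_le_mono2)
  moreover have "2 * (q * (p + 2) + i) + 1 = 2 * (q * p) + 4 * q + 2 * i + 1"
    by (simp add: algebra_simps)
  moreover have "8 * p * (q + 1) = 8 * (q * p) + 8 * p" by (simp add: algebra_simps)
  ultimately have "2 * (q * (p + 2) + i) + 1 \<le> 8 * p * (q + 1)"
    using p \<open>i \<le> p\<close> by linarith
  then show ?thesis using False by (simp add: ix_def weight_def)
qed

lemma weight_le_p: "weight i \<le> p"
  by (simp add: weight_def)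

lemma weight_Suc: "weight (Suc i) \<le> 2 * weight i"
proof -
  have "Suc i div 2 \<le> Suc (i div 2)" by simp
  then have "(2::nat) ^ (Suc i div 2) \<le> 2 ^ Suc (i div 2)" by (intro power_increasing) auto
  then show ?thesis by (simp add: weight_def min_def)
qed

lemma weight_le_sqrt: "real (weight i) \<le> sqrt (2 ^ i)"
proof -
  have "((2::real) ^ (i div 2))\<^sup>2 = 2 ^ (i div 2 * 2)" by (simp add: power_mult)
  also have "\<dots> \<le> 2 ^ i" by (intro power_increasing) auto
  finally have "(2::real) ^ (i div 2) \<le> sqrt (2 ^ i)" by (rule real_le_rsqrt)
  moreover have "real (weight i) \<le> 2 ^ (i div 2)"
    using of_nat_le_iff[of "weight i" "2 ^ (i div 2)", where 'a = real] by (simp add: weight_def)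
  ultimately show ?thesis by linarith
qed

section \<open>The distribution of probe sequences\<close>

definition slot_measure :: "nat \<Rightarrow> nat measure" where
  "slot_measure l = uniform_measure (count_space {1..n}) (slots (lev l))"

definition P :: "probe_seq measure" where
  "P = PiM {1..} slot_measure"

lemma lev_le: "lev l \<le> p"
  by (simp add: lev_def)

lemma emeasure_slots: "i \<le> p \<Longrightarrow> emeasure (count_space {1..n}) (slots i) = of_nat (N i)"
  using slots_subset[of i] by (subst emeasure_count_space) (auto simp: card_slots finite_subset)

lemma prob_space_slot_measure: "prob_space (slot_measure l)"
proof -
  have e: "emeasure (count_space {1..n}) (slots (lev l)) = of_nat (N (lev l))"
    by (rule emeasure_slots[OF lev_le])
  show ?thesis
    unfolding slot_measure_def
  proof (rule prob_space_uniform_measure)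
    show "emeasure (count_space {1..n}) (slots (lev l)) \<noteq> 0"
      unfolding e using N_ge[OF lev_le, of l] by simp
    show "emeasure (count_space {1..n}) (slots (lev l)) \<noteq> \<infinity>"
      unfolding e by simp
  qed
qed

lemma sets_slot_measure [simp]: "sets (slot_measure l) = Pow {1..n}"
  by (simp add: slot_measure_def)

lemma measure_slot_measure:
  assumes "X \<subseteq> {1..n}"
  shows "measure (slot_measure l) X = card (X \<inter> slots (lev l)) / N (lev l)"
proof -
  have "emeasure (slot_measure l) X = of_nat (card (slots (lev l) \<inter> X)) / of_nat (N (lev l))"
    unfolding slot_measure_def using assms slots_subset[of "lev l"]
    by (subst emeasure_uniform_measure)
      (simp_all add: emeasure_count_space_finite le_infI1 card_slots del: One_nat_def)
  also have "\<dots> = ennreal (card (slots (lev l) \<inter> X) / N (lev l))"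
    using N_ge[OF lev_le, of l]
    by (subst divide_ennreal[symmetric]) (auto simp: ennreal_of_nat_eq_real_of_nat)
  finally show ?thesis by (simp add: measure_def Int_commute)
qed

lemma AE_slot_measure: "AE s in slot_measure l. s \<in> slots (lev l)"
  unfolding slot_measure_def using slots_subset[of "lev l"]
  by (intro AE_uniform_measureI) auto

lemma probe_distribution_P: "probe_distribution n P"
  unfolding probe_distribution_def P_def
proof
  show "prob_space (PiM {1..} slot_measure)"
    by (intro prob_space_PiM prob_space_slot_measure)
  show "sets (PiM {1..} slot_measure) = sets (probe_space n)"
    unfolding probe_space_def by (intro sets_PiM_cong) auto
qed

subsection \<open>The algorithm\<close>

definition open_next :: "phase \<Rightarrow> bool" where
  "open_next s = (case s of (i, x, y) \<Rightarrow> i < p \<and> y < reserve_at i)"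

text \<open>The value 0 makes every sample belong to the second stage, whose failure probability
  \<open>beta\<close> then refers to level \<open>i\<close> itself. One law thus covers keys with
  and without the option to overflow.\<close>

definition cut :: "phase \<Rightarrow> nat" where
  "cut s = (case s of (i, x, y) \<Rightarrow> if open_next s then attempts_at i x else 0)"

definition overflows :: "phase \<Rightarrow> nat \<Rightarrow> bool" where
  "overflows s t \<longleftrightarrow> open_next s \<and> cut s \<le> t"

definition probe_level :: "phase \<Rightarrow> nat \<Rightarrow> nat" where
  "probe_level s t = (if overflows s t then Suc (fst s) else fst s)"

definition probe_index :: "phase \<Rightarrow> nat \<Rightarrow> nat" where
  "probe_index s t = ix (probe_level s t) (if overflows s t then t - cut s else t)"

text \<open>When a level reaches its quota, the keys that overflowed from it become the load of the
  new current level, whose own overflow count starts at 0.\<close>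

definition next_phase :: "phase \<Rightarrow> nat \<Rightarrow> phase" where
  "next_phase s t = (case s of (i, x, y) \<Rightarrow>
     if overflows s t then (i, x, Suc y)
     else if i < p \<and> quota_at i \<le> Suc x then (Suc i, y, 0)
     else (i, Suc x, y))"

definition alg :: algorithm where
  "alg = first_fit (\<lambda>mem. probe_index (dec mem)) (\<lambda>mem t. enc (next_phase (dec mem) t)) (n ^ 8)"

lemma insertion_algorithm_alg: "insertion_algorithm n (n ^ 8) alg"
  unfolding alg_def using n_ge
  by (intro insertion_algorithm_first_fit) (simp_all only: probe_index_def ix_pos, simp)

section \<open>The invariant of the table\<close>

text \<open>The last conjunct says that each closed level accounts for exactly its quota of keys;
  through it the number \<open>k\<close> of insertions limits the phase.\<close>

definition inv :: "nat \<Rightarrow> nat set \<Rightarrow> phase \<Rightarrow> bool" where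
  "inv k occ s = (case s of (i, x, y) \<Rightarrow>
     i \<le> p \<and> occ \<subseteq> {1..n} \<and> card (occ \<inter> slots i) = x \<and>
     (i < p \<longrightarrow> x < quota_at i \<and> y \<le> reserve_at i \<and> card (occ \<inter> slots (Suc i)) = y) \<and>
     (i = p \<longrightarrow> y = 0) \<and>
     (\<forall>j. Suc i < j \<longrightarrow> j \<le> p \<longrightarrow> occ \<inter> slots j = {}) \<and>
     k = (\<Sum>j<i. quota_at j) + x + y)"

lemma inv_initial: "inv 0 {} (0, 0, 0)"
  using reserve_less_quota[of 0] p by (auto simp: inv_def)

lemma probe_level_le: "inv k occ s \<Longrightarrow> probe_level s t \<le> p"
  by (auto simp: inv_def probe_level_def overflows_def open_next_def)

lemma insert_Int_same: "a \<in> S \<Longrightarrow> a \<notin> X \<Longrightarrow> finite X \<Longrightarrow> card (insert a X \<inter> S) = Suc (card (X \<inter> S))"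
  by simp

lemma insert_Int_other: "a \<in> S \<Longrightarrow> S \<inter> T = {} \<Longrightarrow> insert a X \<inter> T = X \<inter> T"
  by auto

lemma inv_step:
  assumes inv: "inv k occ s" and free: "a \<notin> occ" and a: "a \<in> slots (probe_level s t)"
  shows "inv (Suc k) (insert a occ) (next_phase s t)"
proof -
  obtain i x y where s: "s = (i, x, y)" by (cases s)
  have i: "i \<le> p" and occ: "occ \<subseteq> {1..n}" and x: "card (occ \<inter> slots i) = x"
    and y: "i < p \<Longrightarrow> x < quota_at i" "i < p \<Longrightarrow> y \<le> reserve_at i" "i < p \<Longrightarrow> card (occ \<inter> slots (Suc i)) = y"
    and last: "i = p \<Longrightarrow> y = 0"
    and empty: "\<And>j. Suc i < j \<Longrightarrow> j \<le> p \<Longrightarrow> occ \<inter> slots j = {}"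
    and k: "k = (\<Sum>j<i. quota_at j) + x + y"
    using inv by (auto simp: inv_def s)
  have fin: "finite occ" using occ finite_subset by blast
  have occ': "insert a occ \<subseteq> {1..n}" using occ a slots_subset by blast
  show ?thesis
  proof (cases "overflows s t")
    case True
    then have ip: "i < p" and yr: "y < reserve_at i" by (auto simp: overflows_def open_next_def s)
    have a: "a \<in> slots (Suc i)" using a True by (simp add: probe_level_def s)
    have "insert a occ \<inter> slots i = occ \<inter> slots i"
      using slots_disjoint[of i "Suc i"] ip by (intro insert_Int_other[OF a]) auto
    moreover have "insert a occ \<inter> slots j = {}" if "Suc i < j" "j \<le> p" for j
      using insert_Int_other[OF a slots_disjoint[OF that]] empty[OF that] by simp
    moreover have "card (insert a occ \<inter> slots (Suc i)) = Suc y"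
      using insert_Int_same[OF a free fin] y(3) ip by simp
    ultimately show ?thesis
      using True ip yr y x k occ' by (simp add: inv_def next_phase_def s)
  next
    case False
    have a: "a \<in> slots i" using a False by (simp add: probe_level_def s)
    have 1: "insert a occ \<inter> slots j = occ \<inter> slots j" if "i < j" "j \<le> p" for j
      by (rule insert_Int_other[OF a slots_disjoint[OF that]])
    have 2: "card (insert a occ \<inter> slots i) = Suc x"
      using insert_Int_same[OF a free fin] x by simp
    show ?thesis
    proof (cases "i < p \<and> quota_at i \<le> Suc x")
      case True
      then have q: "Suc x = quota_at i" using y by auto
      have "card (insert a occ \<inter> slots (Suc i)) = y" using 1[of "Suc i"] True y by simp
      moreover have "card (insert a occ \<inter> slots (Suc (Suc i))) = 0" if "Suc i < p"
        using 1[of "Suc (Suc i)"] empty[of "Suc (Suc i)"] that by simp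
      \<comment> \<open>The newly opened level is not already full: overflow fills at most half of
        it, whereas its quota is at least 7/8 of it.\<close>
      moreover have "y < quota_at (Suc i)" if "Suc i < p"
        using y(2) reserve_Suc[of i] N_le_quota[of "Suc i"] N_ge[of "Suc i"] that by linarith
      moreover have "insert a occ \<inter> slots j = {}" if "Suc (Suc i) < j" "j \<le> p" for j
        using 1[of j] empty[of j] that by simp
      ultimately show ?thesis
        using True False q y x k occ' by (simp add: inv_def next_phase_def s)
    next
      case False
      moreover have "card (insert a occ \<inter> slots (Suc i)) = y" if "i < p"
        using 1[of "Suc i"] that y by simp
      moreover have "insert a occ \<inter> slots j = {}" if "Suc i < j" "j \<le> p" for j
        using 1[of j] empty[of j] that by simp
      ultimately show ?thesis
        using \<open>\<not> overflows s t\<close> 2 y last k occ' i by (auto simp: inv_def next_phase_def s)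
    qed
  qed
qed


subsection \<open>Load bounds\<close>

lemma quota_real: "j \<le> p \<Longrightarrow> real (N j) * (1 - 1 / (4 * 2 ^ p)) \<le> real (quota_at j)"
proof -
  assume "j \<le> p"
  then interpret level "N j" p by (rule level_N)
  have "real (N j div (4 * 2 ^ p)) \<le> real (N j) / real (4 * 2 ^ p)"
    by (rule of_nat_div_le_of_nat)
  moreover have "real (quota_at j) = real (N j) - real (N j div (4 * 2 ^ p))"
    using spare_less unfolding quota_def spare_def by (subst of_nat_diff) auto
  ultimately show ?thesis by (simp add: algebra_simps)
qed

text \<open>The levels before \<open>i\<close> comprise all but \<open>n div 2 ^ i\<close> slots,
  and each quota leaves out at most a share \<open>1 / (4 * 2 ^ p)\<close>.\<close>

lemma sum_quota_ge:
  assumes "i \<le> p"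
  shows "real n - real (n div 2 ^ i) - real n / (4 * 2 ^ p) \<le> real (\<Sum>j<i. quota_at j)"
proof -
  have N: "(\<Sum>j<i. real (N j)) = real n - real (n div 2 ^ i)"
    using arg_cong[OF sum_N[OF assms], of real] by simp
  have "real n / (4 * 2 ^ p) \<ge> (real n - real (n div 2 ^ i)) / (4 * 2 ^ p)"
    by (intro divide_right_mono) auto
  then have "real n - real (n div 2 ^ i) - real n / (4 * 2 ^ p)
      \<le> (real n - real (n div 2 ^ i)) * (1 - 1 / (4 * 2 ^ p))"
    by (simp add: algebra_simps)
  also have "\<dots> = (\<Sum>j<i. real (N j) * (1 - 1 / (4 * 2 ^ p)))"
    by (simp only: N[symmetric] sum_distrib_right)
  also have "\<dots> \<le> (\<Sum>j<i. real (quota_at j))"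
    using assms by (intro sum_mono quota_real) auto
  finally show ?thesis by simp
qed

definition m :: nat where "m = n - n div 2 ^ p"

text \<open>The closed levels already hold all but about \<open>n / 2 ^ i\<close> keys, which forces
  \<open>n - k \<le> 2 * n / 2 ^ i\<close>. Expensive levels are thus reached only late, and this
  yields the amortized bound.\<close>

lemma phase_bound:
  assumes "inv k occ (i, x, y)" "k < m"
  shows "2 ^ i \<le> 2 * real n / (real n - real k)"
proof -
  have i: "i \<le> p" and k: "(\<Sum>j<i. quota_at j) \<le> k" using assms(1) by (auto simp: inv_def)
  have kn: "real k < real n" using assms(2) by (simp add: m_def)
  have "real (n div 2 ^ i) \<le> real n / 2 ^ i" using of_nat_div_le_of_nat[of n "2 ^ i"] by simp
  moreover have "real n / (4 * 2 ^ p) \<le> real n / 2 ^ i"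
  proof (intro divide_left_mono)
    have "(2::real) ^ i \<le> 2 ^ p" using i by (intro power_increasing) auto
    moreover have "(0::real) \<le> 2 ^ p" by simp
    ultimately show "(2::real) ^ i \<le> 4 * 2 ^ p" by linarith
  qed auto
  moreover have "real (\<Sum>j<i. quota_at j) \<le> real k" using k by (rule of_nat_mono)
  ultimately have "real n - real k \<le> 2 * (real n / 2 ^ i)"
    using sum_quota_ge[OF i] by linarith
  then show ?thesis using kn by (simp add: field_simps)
qed

text \<open>At least \<open>D\<close> slots stay free overall, while the closed levels waste at most
  \<open>(D + 1) / 4\<close>; comparing counts leaves at most \<open>(D + 1) / 4\<close> keys for
  the last level.\<close>

lemma last_phase_bound:
  assumes "inv k occ (p, x, y)" "k < m"
  shows "2 * x \<le> N p"
proof -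
  define D where "D = n div 2 ^ p"
  have x: "(\<Sum>j<p. quota_at j) + x = k" using assms(1) by (simp add: inv_def)
  have "n div 2 ^ p \<le> n" by simp
  then have k: "real k < real n - real D" using assms(2) by (simp add: m_def D_def of_nat_diff)
  have "n \<le> (D + 1) * 2 ^ p"
    using dividend_less_div_times[of "2 ^ p" n] by (simp add: D_def)
  then have "real n \<le> real ((D + 1) * 2 ^ p)" by (rule of_nat_mono)
  then have "real n / (4 * 2 ^ p) \<le> (real D + 1) / 4" by (simp add: field_simps)
  moreover have "real (\<Sum>j<p. quota_at j) + real x = real k" using arg_cong[OF x, of real] by simp
  ultimately have "real x \<le> (real D + 1) / 4"
    using sum_quota_ge[of p] k unfolding D_def[symmetric] by linarith
  moreover have "65536 \<le> D" using n_div_ge[of p] by (simp add: D_def)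
  ultimately have "real (2 * x) \<le> real D" by simp
  then have "2 * x \<le> D" by (simp only: of_nat_le_iff)
  then show ?thesis by (simp add: N_def lo_def D_def)
qed

subsection \<open>Insertion of one key\<close>

definition alpha :: "phase \<Rightarrow> real" where
  "alpha s = (case s of (i, x, y) \<Rightarrow> real x / real (N i))"

definition beta :: "phase \<Rightarrow> real" where
  "beta s = (case s of (i, x, y) \<Rightarrow>
     if open_next s then real y / real (N (Suc i)) else real x / real (N i))"

definition stop :: "phase \<Rightarrow> nat set \<Rightarrow> probe_seq \<Rightarrow> nat" where
  "stop s occ h = (LEAST t. h (probe_index s t) \<notin> occ)"

lemma x_less: "inv k occ (i, x, y) \<Longrightarrow> k < m \<Longrightarrow> x < N i"
proof -
  assume inv: "inv k occ (i, x, y)" and k: "k < m"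
  show ?thesis
  proof (cases "i < p")
    case True
    then show ?thesis using inv quota_le[of i] by (simp add: inv_def)
  next
    case False
    then have "i = p" using inv by (simp add: inv_def)
    then show ?thesis using last_phase_bound[of k occ x y] inv k N_ge[of p] by simp
  qed
qed

lemma alpha_bounds: "inv k occ s \<Longrightarrow> k < m \<Longrightarrow> 0 \<le> alpha s \<and> alpha s < 1"
  using x_less[of k occ "fst s" "fst (snd s)" "snd (snd s)"]
  by (auto simp: alpha_def split: prod.splits)

lemma beta_open: "inv k occ s \<Longrightarrow> open_next s \<Longrightarrow> 0 \<le> beta s \<and> beta s \<le> 1 / 2"
proof -
  assume inv: "inv k occ s" and o: "open_next s"
  obtain i x y where s: "s = (i, x, y)" by (cases s)
  have "i < p" "y < reserve_at i" using o by (auto simp: open_next_def s)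
  then have "2 * y \<le> N (Suc i)" "0 < N (Suc i)" using reserve_Suc[of i] N_ge[of "Suc i"] by auto
  then show ?thesis using o by (simp add: beta_def s field_simps flip: of_nat_mult)
qed

lemma beta_bounds: "inv k occ s \<Longrightarrow> k < m \<Longrightarrow> 0 \<le> beta s \<and> beta s < 1"
  using alpha_bounds[of k occ s] beta_open[of k occ s]
  by (cases "open_next s") (auto simp: beta_def alpha_def split: prod.splits)

lemma inj_probe_index:
  assumes "inv k occ s" shows "inj (probe_index s)"
proof (rule injI)
  fix t u assume eq: "probe_index s t = probe_index s u"
  from ix_inject[OF eq[unfolded probe_index_def] probe_level_le[OF assms] probe_level_le[OF assms]]
  show "t = u"
    by (auto simp: probe_level_def overflows_def split: if_splits)
qed

lemma measure_occupied:
  assumes "inv k occ s"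
  shows "measure (slot_measure (probe_index s t)) occ = (if t < cut s then alpha s else beta s)"
proof -
  obtain i x y where s: "s = (i, x, y)" by (cases s)
  have "measure (slot_measure (probe_index s t)) occ
      = card (occ \<inter> slots (probe_level s t)) / N (probe_level s t)"
    using assms probe_level_le[OF assms, of t]
    by (subst measure_slot_measure) (auto simp: inv_def probe_index_def lev_ix)
  then show ?thesis
    using assms by (auto simp: s inv_def probe_level_def overflows_def open_next_def cut_def alpha_def beta_def)
qed

lemma key_law:
  assumes inv: "inv k occ s" and k: "k < m" and w: "\<And>t. 0 \<le> w t"
    and S: "(\<lambda>j. beta s ^ j * w (j + cut s)) sums S"
  shows "(\<integral>\<^sup>+h. ennreal (w (stop s occ h)) \<partial>P)
    = ennreal ((\<Sum>t<cut s. alpha s ^ t * (1 - alpha s) * w t) + alpha s ^ cut s * (1 - beta s) * S)"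
  unfolding P_def stop_def
proof (rule first_failure_law(2)[OF prob_space_slot_measure])
  show "occ \<in> sets (slot_measure (probe_index s t))" for t using inv by (auto simp: inv_def)
  show "inj (probe_index s)" by (rule inj_probe_index[OF inv])
  show "probe_index s t \<in> {1..}" for t by (simp add: probe_index_def ix_pos del: One_nat_def)
  show "measure (slot_measure (probe_index s t)) occ = (if t < cut s then alpha s else beta s)" for t
    by (rule measure_occupied[OF inv])
  show "(\<lambda>t. \<Prod>u<t. if u < cut s then alpha s else beta s) \<longlonglongrightarrow> 0"
    using beta_bounds[OF inv k] by (intro two_phase_lim) auto
  show "0 \<le> w t" for t by (rule w)
  show "(\<lambda>t. (\<Prod>u<t. if u < cut s then alpha s else beta s) *
      (1 - (if t < cut s then alpha s else beta s)) * w t) sums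
      ((\<Sum>t<cut s. alpha s ^ t * (1 - alpha s) * w t) + alpha s ^ cut s * (1 - beta s) * S)"
    by (rule two_phase_sums[OF S])
qed

text \<open>Reduction modulo \<open>n ^ 8\<close> in \<open>alg\<close> therefore preserves the
  phase as long as the invariant holds.\<close>

lemma enc_less_memory:
  assumes "inv k occ s" shows "enc s < n ^ 8"
proof -
  obtain i x y where s: "s = (i, x, y)" by (cases s)
  have i: "i \<le> p" and x: "x = card (occ \<inter> slots i)" and y: "y \<le> reserve_at i \<or> y = 0"
    using assms by (auto simp: s inv_def)
  have "x \<le> N i" unfolding x card_slots[symmetric] by (intro card_mono) auto
  moreover have "y \<le> N i" using y reserve_less_quota[OF i] quota_le[OF i] by linarith
  ultimately show ?thesis unfolding s
    using i p_le_n n_ge N_le[of i] by (intro enc_less) linarith+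
qed

text \<open>Almost surely some sample is free and every sample lies in its level; on this event the
  run is determined by \<open>stop\<close>, and \<open>inv_step\<close> applies.\<close>

lemma AE_insert_key:
  assumes inv: "inv k occ s" and k: "k < m"
  shows "AE h in P. insert_key alg occ (enc s) h
        = Some (probe_index s (stop s occ h), Suc (stop s occ h), enc (next_phase s (stop s occ h)))
      \<and> inv (Suc k) (insert (h (probe_index s (stop s occ h))) occ) (next_phase s (stop s occ h))"
proof -
  have "AE h in P. \<exists>t. h (probe_index s t) \<notin> occ"
    unfolding P_def
  \<comment> \<open>Termination does not depend on the cost function, so the zero cost serves as
    instance.\<close>
  proof (rule first_failure_law(1)[OF prob_space_slot_measure, where w = "\<lambda>_. 0" and S = 0])
    show "occ \<in> sets (slot_measure (probe_index s t))" for t using inv by (auto simp: inv_def)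
    show "inj (probe_index s)" by (rule inj_probe_index[OF inv])
    show "probe_index s t \<in> {1..}" for t by (simp add: probe_index_def ix_pos del: One_nat_def)
    show "measure (slot_measure (probe_index s t)) occ = (if t < cut s then alpha s else beta s)" for t
      by (rule measure_occupied[OF inv])
    show "(\<lambda>t. \<Prod>u<t. if u < cut s then alpha s else beta s) \<longlonglongrightarrow> 0"
      using beta_bounds[OF inv k] by (intro two_phase_lim) auto
  qed auto
  moreover have "AE h in P. \<forall>l\<in>{1..}. h l \<in> slots (lev l)"
    unfolding P_def by (rule AE_PiM_all_components[OF prob_space_slot_measure AE_slot_measure])
  ultimately show ?thesis
  proof eventually_elim
    case (elim h)
    let ?T = "stop s occ h"
    have T: "h (probe_index s ?T) \<notin> occ" unfolding stop_def using elim(1) by (rule LeastI_ex)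
    have T_least: "h (probe_index s t) \<in> occ" if "t < ?T" for t
      using not_less_Least[of t] that unfolding stop_def by blast
    have pos: "1 \<le> probe_index s ?T" by (simp add: probe_index_def ix_pos del: One_nat_def)
    then have "h (probe_index s ?T) \<in> slots (probe_level s ?T)"
      using bspec[OF elim(2), of "probe_index s ?T"] probe_level_le[OF inv, of ?T]
      by (simp add: probe_index_def lev_ix del: One_nat_def)
    from inv_step[OF inv T this]
    have inv': "inv (Suc k) (insert (h (probe_index s ?T)) occ) (next_phase s ?T)" .
    moreover have "insert_key alg occ (enc s) h
        = Some (probe_index s ?T, Suc ?T, enc (next_phase s ?T) mod n ^ 8)"
      using insert_key_first_fit[of "\<lambda>mem. probe_index (dec mem)" "enc s" ?T h occ] pos T T_least
      by (simp add: alg_def)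
    ultimately show ?case using enc_less_memory[OF inv'] by simp
  qed
qed

section \<open>The potential across all levels\<close>

abbreviation M_at :: "nat \<Rightarrow> real" where "M_at i \<equiv> level.M (N i) p"

text \<open>The terms \<open>1 / M_at j\<close> are set aside for the initial potentials of the
  levels still to be opened. The last level needs no potential, as it stays at most half
  full.\<close>

definition psi :: "phase \<Rightarrow> real" where
  "psi s = (case s of (i, x, y) \<Rightarrow>
     if i < p then level.pot (N i) p x y + (\<Sum>j\<in>{Suc i..<p}. 1 / M_at j) else 0)"

lemma M_at_pos: "i \<le> p \<Longrightarrow> 0 < M_at i"
  using level.M_ge[OF level_N, of i] by simp

lemma pot_le_psi: "i < p \<Longrightarrow> level.pot (N i) p x y \<le> psi (i, x, y)"
  unfolding psi_def by (auto intro!: sum_nonneg less_imp_le[OF M_at_pos])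

lemma psi_nonneg: "0 \<le> psi s"
proof -
  obtain i x y where s: "s = (i, x, y)" by (cases s)
  show ?thesis
    using pot_le_psi[of i x y] level.pot_nonneg[OF level_N, of i x y]
    by (cases "i < p") (auto simp: s psi_def)
qed

text \<open>Each \<open>1 / M_at j\<close> is at most \<open>1 / N j\<close> plus
  \<open>1 / (4 * 2 ^ p)\<close>. The first part is geometric and dominated by the smallest levels,
  the second adds up to \<open>p / (4 * 2 ^ p)\<close>.\<close>

lemma psi_initial: "psi (0, 0, 0) \<le> 2"
proof -
  have "psi (0, 0, 0) \<le> 1 / M_at 0 + (\<Sum>j\<in>{Suc 0..<p}. 1 / M_at j)"
    using p level.pot_initial[OF level_N, of 0 0] by (simp add: psi_def)
  also have "\<dots> = (\<Sum>j<p. 1 / M_at j)"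
    using p by (simp add: lessThan_atLeast0 sum.atLeast_Suc_lessThan)
  also have "\<dots> \<le> (\<Sum>j<p. 2 ^ j * (4 / real n) + 1 / (4 * 2 ^ p))"
  proof (intro sum_mono)
    fix j assume "j \<in> {..<p}"
    then have j: "j < p" by simp
    have "real n \<le> real (N j * 2 ^ (j + 2))" using n_le_N[OF j] by (rule of_nat_mono)
    then have "1 / real (N j) \<le> 2 ^ j * (4 / real n)"
      using n_ge N_ge[of j] j by (simp add: field_simps)
    moreover have "1 / M_at j = 1 / real (N j) \<or> 1 / M_at j = 1 / (4 * 2 ^ p)"
      using j by (simp add: level.M_def[OF level_N] min_def)
    moreover have "0 \<le> 1 / real (N j)" "(0::real) \<le> 1 / (4 * 2 ^ p)" by simp_all
    ultimately show "1 / M_at j \<le> 2 ^ j * (4 / real n) + 1 / (4 * 2 ^ p)" by linarith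
  qed
  also have "\<dots> = (2 ^ p - 1) * (4 / real n) + real p / (4 * 2 ^ p)"
  proof -
    have "(\<Sum>j<p. (2::real) ^ j) = 2 ^ p - 1" by (simp add: geometric_sum)
    then show ?thesis by (simp only: sum.distrib sum_distrib_right[symmetric]) simp
  qed
  also have "\<dots> \<le> 1 + 1"
  proof (intro add_mono)
    have "real (65536 * 2 ^ p) \<le> real n" using n by (rule of_nat_mono)
    then have "(2 ^ p - 1) * 4 \<le> real n" by simp
    then show "(2 ^ p - 1) * (4 / real n) \<le> 1" using n_ge by simp
    have "real p \<le> 2 ^ p" using less_exp[of p] by (simp add: of_nat_less_two_power less_imp_le)
    moreover have "(0::real) \<le> 2 ^ p" by simp
    ultimately have "real p \<le> 4 * 2 ^ p" by linarith
    then show "real p / (4 * 2 ^ p) \<le> 1" by simp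
  qed
  finally show ?thesis by simp
qed

lemma spare_less_gap: "x < quota_at i \<Longrightarrow> i \<le> p \<Longrightarrow> level.spare (N i) p < N i - x"
  using level.quota_def[OF level_N, of i] by simp

text \<open>When level \<open>i\<close> closes, the amount \<open>1 / M_at (Suc i)\<close> set aside
  pays for the initial potential of the next level, and the nonnegative old potential is
  dropped.\<close>

lemma psi_advance:
  assumes i: "i < p" and gap: "level.spare (N i) p < N i - x"
  shows "(if quota_at i \<le> Suc x then psi (Suc i, y, 0) else psi (i, Suc x, y))
    \<le> level.pot (N i) p (Suc x) y + (\<Sum>j\<in>{Suc i..<p}. 1 / M_at j)"
proof -
  have "psi (Suc i, y, 0) \<le> (\<Sum>j\<in>{Suc i..<p}. 1 / M_at j)"
  proof (cases "Suc i < p")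
    case True
    then have "psi (Suc i, y, 0) \<le> 1 / M_at (Suc i) + (\<Sum>j\<in>{Suc (Suc i)..<p}. 1 / M_at j)"
      using level.pot_initial[OF level_N, of "Suc i" y] by (simp add: psi_def)
    with True show ?thesis by (simp add: sum.atLeast_Suc_lessThan)
  next
    case False
    then show ?thesis by (simp add: psi_def)
  qed
  moreover have "0 \<le> level.pot (N i) p (Suc x) y"
    using level.pot_nonneg[OF level_N] i by simp
  ultimately show ?thesis using i by (simp add: psi_def)
qed

lemma psi_step:
  assumes inv: "inv k occ s" and k: "k < m"
  shows "(\<integral>\<^sup>+h. ennreal (psi (next_phase s (stop s occ h))) \<partial>P) \<le> ennreal (psi s)"
proof -
  obtain i x y where s: "s = (i, x, y)" by (cases s)
  \<comment> \<open>\<open>A\<close> is the new potential if the key ends in level \<open>i\<close>,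
    \<open>B\<close> the one if it ends in the second stage. Their weights are
    \<open>1 - alpha s ^ cut s\<close> and \<open>alpha s ^ cut s\<close>.\<close>
  define A where "A = (if i < p \<and> quota_at i \<le> Suc x then psi (Suc i, y, 0) else psi (i, Suc x, y))"
  define B where "B = (if open_next s then psi (i, x, Suc y) else A)"
  have w1: "psi (next_phase s t) = A" if "t < cut s" for t
    using that by (auto simp: s A_def next_phase_def overflows_def)
  have w2: "psi (next_phase s (j + cut s)) = B" for j
    by (auto simp: s A_def B_def next_phase_def overflows_def)
  have b: "0 \<le> beta s" "beta s < 1" using beta_bounds[OF inv k] by auto
  have S: "(\<lambda>j. beta s ^ j * psi (next_phase s (j + cut s))) sums (1 / (1 - beta s) * B)"
    unfolding w2 using b by (intro sums_mult2 geometric_sums) auto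
  have "(\<Sum>t<cut s. alpha s ^ t * (1 - alpha s) * psi (next_phase s t)) = (1 - alpha s ^ cut s) * A"
    by (subst sum_geometric_telescope[symmetric]) (simp add: w1)
  with key_law[OF inv k, where w = "\<lambda>t. psi (next_phase s t)", OF psi_nonneg S] b
  have "(\<integral>\<^sup>+h. ennreal (psi (next_phase s (stop s occ h))) \<partial>P)
      = ennreal ((1 - alpha s ^ cut s) * A + alpha s ^ cut s * B)"
    by simp
  also have "\<dots> \<le> ennreal (psi s)"
  proof (rule ennreal_leI)
    have i: "i \<le> p" using inv by (simp add: inv_def s)
    define E where "E = (\<Sum>j\<in>{Suc i..<p}. 1 / M_at j)"
    have gap: "level.spare (N i) p < N i - x" if "i < p"
      using inv that by (intro spare_less_gap) (auto simp: inv_def s)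
    have A: "A \<le> level.pot (N i) p (Suc x) y + E" if "i < p"
      using psi_advance[OF that gap[OF that], of y] that by (simp add: A_def E_def)
    show "(1 - alpha s ^ cut s) * A + alpha s ^ cut s * B \<le> psi s"
    proof (cases "open_next s")
      case True
      then have ip: "i < p" by (simp add: open_next_def s)
      let ?r = "(real x / real (N i)) ^ attempts_at i x"
      have r: "alpha s ^ cut s = ?r" using True by (simp add: alpha_def cut_def s)
      have r1: "?r \<le> 1"
        using alpha_bounds[OF inv k] by (auto simp flip: r intro: power_le_one)
      have B: "B = level.pot (N i) p x (Suc y) + E" using True ip by (simp add: B_def psi_def E_def)
      have "(1 - ?r) * A + ?r * B
          \<le> (1 - ?r) * (level.pot (N i) p (Suc x) y + E) + ?r * (level.pot (N i) p x (Suc y) + E)"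
        unfolding B using A[OF ip] r1 by (intro add_mono mult_left_mono) auto
      also have "\<dots> = (?r * level.pot (N i) p x (Suc y) + (1 - ?r) * level.pot (N i) p (Suc x) y) + E"
        by (simp add: algebra_simps)
      also have "\<dots> \<le> level.pot (N i) p x y + E"
        using level.pot_supermartingale[OF level_N gap[OF ip], of y] ip by simp
      finally show ?thesis unfolding r using ip by (simp add: s psi_def E_def)
    next
      case False
      then have "cut s = 0" by (simp add: cut_def s)
      moreover have "A \<le> psi s"
      proof (cases "i < p")
        case True
        then show ?thesis
          using A[OF True] level.pot_Suc_x_le[OF level_N gap[OF True], of y] by (simp add: s psi_def E_def)
      qed (simp add: A_def s psi_def)
      ultimately show ?thesis using False by (simp add: B_def)
    qed
  qed
  finally show ?thesis .
qed

text \<open>The left side is the mean number of second-stage samples. It is at most 2 in the next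
  level or in the last one, both at most half full; otherwise the reserve is exhausted and the
  potential is at least \<open>M_at i\<close>.\<close>

lemma inverse_gap_le:
  assumes inv: "inv k occ s" and k: "k < m"
  shows "1 / (1 - beta s) \<le> 2 + psi s"
proof (cases "open_next s")
  case True
  then have "1 / (1 - beta s) \<le> 2" using beta_open[OF inv True] by (simp add: field_simps)
  then show ?thesis using psi_nonneg[of s] by simp
next
  case False
  obtain i x y where s: "s = (i, x, y)" by (cases s)
  have x: "x < N i" using x_less[of k occ i x y] inv k by (simp add: s)
  have gap: "1 / (1 - beta s) = real (N i) / real (N i - x)"
    using False x by (simp add: beta_def s field_simps)
  show ?thesis
  proof (cases "i < p")
    case True
    have "level.spare (N i) p < N i - x" using inv True by (intro spare_less_gap) (auto simp: inv_def s)
    then have "1 / (1 - beta s) \<le> M_at i"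
      unfolding gap using True by (intro level.div_le_M[OF level_N]) auto
    also have "\<dots> \<le> level.pot (N i) p x y"
      using False True by (intro level.pot_ge_M[OF level_N]) (auto simp: open_next_def s)
    also have "\<dots> \<le> psi s" using pot_le_psi[OF True] by (simp add: s)
    finally show ?thesis by simp
  next
    case False
    then have "i = p" using inv by (simp add: inv_def s)
    then have "2 * x \<le> N i" using last_phase_bound[of k occ x y] inv k by (simp add: s)
    then have "real (N i) / real (N i - x) \<le> 2" using x by (simp add: field_simps of_nat_diff)
    then show ?thesis using psi_nonneg[of s] by (simp add: gap)
  qed
qed

section \<open>Expected cost of one insertion\<close>

lemma attempts_cost:
  assumes inv: "inv k occ s" and k: "k < m"
  shows "(1 - alpha s) * (real (cut s))\<^sup>2 \<le> 4096\<^sup>2" "cut s \<le> 2048 * p"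
proof -
  obtain i x y where s: "s = (i, x, y)" by (cases s)
  have i: "i \<le> p" using inv by (simp add: inv_def s)
  have x: "x < N i" using x_less[of k occ i x y] inv k by (simp add: s)
  have "1 - alpha s = real (N i - x) / real (N i)"
    using x by (simp add: alpha_def s field_simps of_nat_diff)
  then show "(1 - alpha s) * (real (cut s))\<^sup>2 \<le> 4096\<^sup>2"
    using level.attempts_square_le[OF level_N x] i by (simp add: cut_def s)
  show "cut s \<le> 2048 * p"
    using level.attempts_le[OF level_N, of i x] i by (simp add: cut_def s)
qed

text \<open>The first stage contributes at most \<open>8 * 4096 ^ 2\<close> times the weight by
  \<open>attempts_cost\<close>, the second at most \<open>16 * (2 + psi s)\<close> times the weight.
  The constant is \<open>8 * 4096 ^ 2 + 32\<close>.\<close>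

lemma probe_index_cost:
  assumes inv: "inv k occ s" and k: "k < m"
  shows "(\<integral>\<^sup>+h. ennreal (real (probe_index s (stop s occ h))) \<partial>P)
    \<le> ennreal (134217760 * real (weight (fst s)) * (1 + psi s))"
proof -
  define b where "b = real (weight (fst s))"
  \<comment> \<open>A majorant of the position that is linear within each stage; the factor 16
    allows for the next level having up to twice the weight.\<close>
  define w where "w t = (if t < cut s then 8 * b * real (t + 1) else 16 * b * real (t - cut s + 1))" for t
  have b0: "0 \<le> b" by (simp add: b_def)
  have be: "0 \<le> beta s" "beta s < 1" using beta_bounds[OF inv k] by auto
  have al: "0 \<le> alpha s" "alpha s < 1" using alpha_bounds[OF inv k] by auto
  have w_nonneg: "0 \<le> w t" for t using b0 by (simp add: w_def)
  have le_w: "real (probe_index s t) \<le> w t" for t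
  proof -
    have i: "fst s \<le> p" using inv by (auto simp: inv_def)
    show ?thesis
    proof (cases "overflows s t")
      case True
      then have "Suc (fst s) \<le> p" by (auto simp: overflows_def open_next_def split: prod.splits)
      from ix_le[OF this, of "t - cut s"]
      have "probe_index s t \<le> 8 * weight (Suc (fst s)) * (t - cut s + 1)"
        using True by (simp add: probe_index_def probe_level_def)
      also have "\<dots> \<le> 8 * (2 * weight (fst s)) * (t - cut s + 1)"
        by (intro mult_right_mono mult_left_mono weight_Suc) auto
      finally have "real (probe_index s t) \<le> real (8 * (2 * weight (fst s)) * (t - cut s + 1))"
        by (rule of_nat_mono)
      then show ?thesis using True by (simp add: w_def b_def overflows_def algebra_simps)
    next
      case False
      have "probe_index s t \<le> 8 * weight (fst s) * (t + 1)"
        using ix_le[OF i, of t] False by (simp add: probe_index_def probe_level_def)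
      then have "real (probe_index s t) \<le> real (8 * weight (fst s) * (t + 1))"
        by (rule of_nat_mono)
      then have *: "real (probe_index s t) \<le> 8 * b * real (t + 1)" by (simp add: b_def algebra_simps)
      show ?thesis
      proof (cases "t < cut s")
        case False
        with \<open>\<not> overflows s t\<close> have "cut s = 0" by (auto simp: overflows_def cut_def split: prod.splits)
        then have "w t = 2 * (8 * b * real (t + 1))" by (simp add: w_def)
        moreover have "0 \<le> 8 * b * real (t + 1)" using b0 by simp
        ultimately show ?thesis using * by linarith
      qed (use * in \<open>simp add: w_def\<close>)
    qed
  qed
  have "(\<lambda>j. 16 * b * (beta s ^ j * real (j + 1))) sums (16 * b * (1 / (1 - beta s)\<^sup>2))"
    by (intro sums_mult geometric_mean_sums be)
  then have "(\<lambda>j. beta s ^ j * w (j + cut s)) sums (16 * b * (1 / (1 - beta s)\<^sup>2))"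
    by (simp add: w_def algebra_simps)
  from key_law[OF inv k w_nonneg this]
  have "(\<integral>\<^sup>+h. ennreal (w (stop s occ h)) \<partial>P) = ennreal ((\<Sum>t<cut s. alpha s ^ t * (1 - alpha s) * w t)
      + alpha s ^ cut s * (1 - beta s) * (16 * b * (1 / (1 - beta s)\<^sup>2)))" .
  also have "\<dots> \<le> ennreal (134217760 * b * (1 + psi s))"
  proof (rule ennreal_leI)
    have "(\<Sum>t<cut s. alpha s ^ t * (1 - alpha s) * w t) \<le> (\<Sum>t<cut s. 1 * (1 - alpha s) * (8 * b * real (cut s)))"
      using al b0 by (intro sum_mono mult_mono) (auto simp: w_def power_le_one intro!: mult_left_mono)
    also have "\<dots> = 8 * b * ((1 - alpha s) * (real (cut s))\<^sup>2)"
      by (simp add: power2_eq_square)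
    also have "\<dots> \<le> 8 * b * 4096\<^sup>2"
      using b0 by (intro mult_left_mono attempts_cost[OF inv k]) auto
    finally have 1: "(\<Sum>t<cut s. alpha s ^ t * (1 - alpha s) * w t) \<le> 8 * b * 4096\<^sup>2" .
    have "(1 - beta s) * (16 * b * (1 / (1 - beta s)\<^sup>2)) = 16 * b * (1 / (1 - beta s))"
      using be by (simp add: power2_eq_square)
    also have "\<dots> \<le> 16 * b * (2 + psi s)"
      using b0 by (intro mult_left_mono inverse_gap_le[OF inv k]) auto
    finally have tail: "(1 - beta s) * (16 * b * (1 / (1 - beta s)\<^sup>2)) \<le> 16 * b * (2 + psi s)" .
    have "alpha s ^ cut s * ((1 - beta s) * (16 * b * (1 / (1 - beta s)\<^sup>2))) \<le> 1 * (16 * b * (2 + psi s))"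
      by (rule mult_mono[OF _ tail]) (use al be b0 in \<open>auto simp: power_le_one\<close>)
    then have 2: "alpha s ^ cut s * (1 - beta s) * (16 * b * (1 / (1 - beta s)\<^sup>2)) \<le> 16 * b * (2 + psi s)"
      by (simp only: mult.assoc mult_1_left)
    have 3: "0 \<le> b * psi s" using b0 psi_nonneg by simp
    have 4: "8 * b * 4096\<^sup>2 + 16 * b * (2 + psi s) = 134217760 * b + 16 * (b * psi s)"
      "134217760 * b * (1 + psi s) = 134217760 * b + 134217760 * (b * psi s)"
      by (simp_all add: algebra_simps)
    show "(\<Sum>t<cut s. alpha s ^ t * (1 - alpha s) * w t)
      + alpha s ^ cut s * (1 - beta s) * (16 * b * (1 / (1 - beta s)\<^sup>2)) \<le> 134217760 * b * (1 + psi s)"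
      using add_mono[OF 1 2] 3 unfolding 4 by linarith
  qed
  finally show ?thesis
    unfolding b_def[symmetric]
    by (rule order_trans[rotated]) (intro nn_integral_mono ennreal_leI le_w)
qed

text \<open>At most \<open>2048 * p\<close> attempts precede a second stage of mean length at most
  \<open>2 + psi s\<close>, whence 2050.\<close>

lemma stop_cost:
  assumes inv: "inv k occ s" and k: "k < m"
  shows "(\<integral>\<^sup>+h. ennreal (real (Suc (stop s occ h))) \<partial>P) \<le> ennreal (2050 * real p * (1 + psi s))"
proof -
  define c where "c = real (cut s)"
  define w where "w t = (if t < cut s then c else c + real (t - cut s + 1))" for t
  have be: "0 \<le> beta s" "beta s < 1" using beta_bounds[OF inv k] by auto
  have al: "0 \<le> alpha s" "alpha s < 1" using alpha_bounds[OF inv k] by auto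
  have w_nonneg: "0 \<le> w t" for t by (simp add: w_def c_def)
  have le_w: "real (Suc t) \<le> w t" for t by (simp add: w_def c_def of_nat_diff)
  have "(\<lambda>j. beta s ^ j * c + beta s ^ j * real (j + 1)) sums (1 / (1 - beta s) * c + 1 / (1 - beta s)\<^sup>2)"
    using be by (intro sums_add sums_mult2 geometric_sums geometric_mean_sums) auto
  then have "(\<lambda>j. beta s ^ j * w (j + cut s)) sums (1 / (1 - beta s) * c + 1 / (1 - beta s)\<^sup>2)"
    by (simp add: w_def distrib_left)
  from key_law[OF inv k w_nonneg this]
  have "(\<integral>\<^sup>+h. ennreal (w (stop s occ h)) \<partial>P) = ennreal ((\<Sum>t<cut s. alpha s ^ t * (1 - alpha s) * w t)
      + alpha s ^ cut s * (1 - beta s) * (1 / (1 - beta s) * c + 1 / (1 - beta s)\<^sup>2))" .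
  also have "(\<Sum>t<cut s. alpha s ^ t * (1 - alpha s) * w t) = (1 - alpha s ^ cut s) * c"
    by (subst sum_geometric_telescope[symmetric]) (simp add: w_def)
  also have "alpha s ^ cut s * (1 - beta s) * (1 / (1 - beta s) * c + 1 / (1 - beta s)\<^sup>2)
      = alpha s ^ cut s * (c + 1 / (1 - beta s))"
  proof -
    have "d * (1 / d * c + 1 / d\<^sup>2) = c + 1 / d" if "0 < d" for d :: real
      using that by (simp add: field_simps power2_eq_square)
    from this[of "1 - beta s"] be show ?thesis by (simp add: mult.assoc)
  qed
  also have "(1 - alpha s ^ cut s) * c + alpha s ^ cut s * (c + 1 / (1 - beta s))
      = c + alpha s ^ cut s * (1 / (1 - beta s))"
    by (simp add: algebra_simps)
  also have "ennreal \<dots> \<le> ennreal (2050 * real p * (1 + psi s))"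
  proof (rule ennreal_leI)
    have "alpha s ^ cut s * (1 / (1 - beta s)) \<le> 1 * (2 + psi s)"
      using al be by (intro mult_mono inverse_gap_le[OF inv k]) (auto simp: power_le_one)
    moreover have "c \<le> 2048 * real p"
      using of_nat_mono[OF attempts_cost(2)[OF inv k], where 'a = real] by (simp add: c_def)
    moreover have "psi s \<le> real p * psi s" "1 \<le> real p"
      using p psi_nonneg[of s] by (simp_all add: mult_le_cancel_right1)
    ultimately have "c + alpha s ^ cut s * (1 / (1 - beta s)) \<le> 2048 * real p + (2 + psi s)"
      by (intro add_mono) auto
    also have "\<dots> \<le> 2050 * real p + 2050 * (real p * psi s)"
      using \<open>psi s \<le> real p * psi s\<close> \<open>1 \<le> real p\<close> psi_nonneg[of s] by linarith
    also have "\<dots> = 2050 * real p * (1 + psi s)" by (simp add: algebra_simps)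
    finally show "c + alpha s ^ cut s * (1 / (1 - beta s)) \<le> 2050 * real p * (1 + psi s)" .
  qed
  finally show ?thesis
    by (rule order_trans[rotated]) (intro nn_integral_mono ennreal_leI le_w)
qed

subsection \<open>The whole sequence of insertions\<close>

text \<open>The value infinity on failed or invalid states makes a finite mean also express that the
  invariant holds almost surely.\<close>

definition potential :: "nat \<Rightarrow> (nat set \<times> nat) option \<Rightarrow> ennreal" where
  "potential k st = (case st of None \<Rightarrow> \<infinity>
     | Some (occ, mem) \<Rightarrow> if inv k occ (dec mem) then ennreal (psi (dec mem)) else \<infinity>)"

definition insert_state ::
  "(nat set \<times> nat) option \<Rightarrow> probe_seq \<Rightarrow> (nat set \<times> nat) option" where
  "insert_state st h = (case st of None \<Rightarrow> None
     | Some (occ, mem) \<Rightarrow> (case insert_key alg occ mem h of None \<Rightarrow> None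
         | Some (j, t, mem') \<Rightarrow> Some (insert (h j) occ, mem')))"

definition insert_cost ::
  "(nat \<times> nat \<times> nat \<Rightarrow> nat) \<Rightarrow> (nat set \<times> nat) option \<Rightarrow> probe_seq \<Rightarrow> ennreal" where
  "insert_cost c st h = (case st of None \<Rightarrow> \<infinity>
     | Some (occ, mem) \<Rightarrow> (case insert_key alg occ mem h of None \<Rightarrow> \<infinity> | Some r \<Rightarrow> of_nat (c r)))"

lemma measurable_insert_state: "insert_state st \<in> probe_space n \<rightarrow>\<^sub>M count_space UNIV"
proof (cases st)
  case None
  then show ?thesis by (simp add: insert_state_def[abs_def])
next
  case (Some om)
  obtain occ mem where om: "om = (occ, mem)" by (cases om)
  have "(\<lambda>h. case r of None \<Rightarrow> None | Some (j, t, mem') \<Rightarrow> Some (insert (h j) occ, mem'))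
      \<in> probe_space n \<rightarrow>\<^sub>M count_space UNIV" for r :: "(nat \<times> nat \<times> nat) option"
  proof (cases r)
    case (Some q)
    obtain j t mem' where q: "q = (j, t, mem')" by (cases q)
    have "(\<lambda>h. h j) \<in> probe_space n \<rightarrow>\<^sub>M count_space UNIV"
    proof (cases "1 \<le> j")
      case False
      \<comment> \<open>An arbitrary result may carry position 0, which lies outside the index set;
        there every sequence in the space takes the same default value.\<close>
      then have "h j = undefined" if "h \<in> space (probe_space n)" for h
        using that by (auto simp: probe_space_def space_PiM PiE_def extensional_def)
      then show ?thesis by (subst measurable_cong[where g = "\<lambda>_. undefined"]) auto
    qed (rule measurable_probe)
    then have "(\<lambda>h. Some (insert (h j) occ, mem')) \<in> probe_space n \<rightarrow>\<^sub>M count_space UNIV"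
      by (rule measurable_compose) simp
    then show ?thesis by (simp add: Some q)
  qed simp
  from measurable_compose_countable[OF this measurable_insert_key[OF insertion_algorithm_alg]]
  show ?thesis by (simp add: insert_state_def[abs_def] Some om)
qed

lemma measurable_insert_cost: "insert_cost c st \<in> borel_measurable (probe_space n)"
proof (cases st)
  case (Some om)
  obtain occ mem where om: "om = (occ, mem)" by (cases om)
  have "(\<lambda>h. (\<lambda>r. case r of None \<Rightarrow> \<infinity> | Some r \<Rightarrow> of_nat (c r)) (insert_key alg occ mem h))
      \<in> borel_measurable (probe_space n)"
    by (rule measurable_compose[OF measurable_insert_key[OF insertion_algorithm_alg]]) simp
  then show ?thesis by (simp add: insert_cost_def[abs_def] Some om)
qed (simp add: insert_cost_def[abs_def])

lemma table_Suc: "table alg \<omega> (Suc k) = insert_state (table alg \<omega> k) (\<omega> (Suc k))"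
  by (simp add: insert_state_def)

lemma potential_cases:
  obtains "potential k st = \<infinity>"
  | occ s where "st = Some (occ, enc s)" "inv k occ s" "potential k st = ennreal (psi s)"
proof (cases "potential k st = \<infinity>")
  case False
  then obtain occ mem where "st = Some (occ, mem)" "inv k occ (dec mem)"
    by (auto simp: potential_def split: option.splits if_splits)
  then show ?thesis using that(2)[of occ "dec mem"] by (simp add: potential_def)
qed (rule that(1))

lemma potential_step:
  assumes k: "k < m"
  shows "(\<integral>\<^sup>+h. potential (Suc k) (insert_state st h) \<partial>P) \<le> potential k st"
proof (cases rule: potential_cases[of k st])
  case (2 occ s)
  have "(\<integral>\<^sup>+h. potential (Suc k) (insert_state st h) \<partial>P)
      = (\<integral>\<^sup>+h. ennreal (psi (next_phase s (stop s occ h))) \<partial>P)"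
  proof (rule nn_integral_cong_AE)
    show "AE h in P. potential (Suc k) (insert_state st h) = ennreal (psi (next_phase s (stop s occ h)))"
      using AE_insert_key[OF 2(2) k]
      by eventually_elim (simp add: potential_def insert_state_def 2(1))
  qed
  then show ?thesis using psi_step[OF 2(2) k] 2(3) by simp
qed simp

lemma measurable_state_fun:
  "k \<le> m \<Longrightarrow> (\<lambda>\<omega>. (f (table alg \<omega> k) :: ennreal)) \<in> borel_measurable (keys m P)"
  by (rule measurable_compose[OF measurable_table[OF insertion_algorithm_alg probe_distribution_P]]) auto

text \<open>The potential is a supermartingale along the insertions, so its mean never exceeds the
  initial bound 2.\<close>

lemma expected_potential:
  "k \<le> m \<Longrightarrow> (\<integral>\<^sup>+\<omega>. potential k (table alg \<omega> k) \<partial>keys m P) \<le> 2"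
proof (induction k)
  case 0
  interpret prob_space "keys m P"
    unfolding keys_def using probe_distribution_P
    by (intro prob_space_PiM) (simp add: probe_distribution_def)
  have "potential 0 (table alg \<omega> 0) \<le> ennreal 2" for \<omega>
    using psi_initial inv_initial by (simp add: potential_def ennreal_leI del: ennreal_numeral)
  then have "(\<integral>\<^sup>+\<omega>. potential 0 (table alg \<omega> 0) \<partial>keys m P) \<le> (\<integral>\<^sup>+\<omega>. 2 \<partial>keys m P)"
    by (intro nn_integral_mono) simp
  then show ?case by (simp add: emeasure_space_1)
next
  case (Suc k)
  have "(\<integral>\<^sup>+\<omega>. potential (Suc k) (table alg \<omega> (Suc k)) \<partial>keys m P)
      = (\<integral>\<^sup>+\<omega>. (\<integral>\<^sup>+h. potential (Suc k) (insert_state (table alg \<omega> k) h) \<partial>P) \<partial>keys m P)"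
    unfolding table_Suc using Suc.prems
    by (intro nn_integral_table_key[OF insertion_algorithm_alg probe_distribution_P]
        measurable_compose[OF measurable_insert_state]) auto
  also have "\<dots> \<le> (\<integral>\<^sup>+\<omega>. potential k (table alg \<omega> k) \<partial>keys m P)"
    using Suc.prems by (intro nn_integral_mono potential_step) auto
  also have "\<dots> \<le> 2" using Suc by simp
  finally show ?case .
qed

text \<open>Given the state, a key costs at most \<open>B * (1 + psi s)\<close> on average; the mean
  potential is at most 2, which gives \<open>3 * B\<close>.\<close>

lemma insert_cost_le:
  assumes k: "k < m" and B: "0 < B"
    and cost: "\<And>occ s. inv k occ s \<Longrightarrow>
      (\<integral>\<^sup>+h. ennreal (real (c (probe_index s (stop s occ h), Suc (stop s occ h),
        enc (next_phase s (stop s occ h))))) \<partial>P) \<le> ennreal (B * (1 + psi s))"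
  shows "(\<integral>\<^sup>+\<omega>. insert_cost c (table alg \<omega> k) (\<omega> (Suc k)) \<partial>keys m P) \<le> ennreal (3 * B)"
proof -
  interpret prob_space "keys m P"
    unfolding keys_def using probe_distribution_P
    by (intro prob_space_PiM) (simp add: probe_distribution_def)
  have *: "(\<integral>\<^sup>+h. insert_cost c st h \<partial>P) \<le> ennreal B * (1 + potential k st)" for st
  proof (cases rule: potential_cases[of k st])
    case 1
    then show ?thesis using B by (simp add: ennreal_mult_top)
  next
    case (2 occ s)
    have "(\<integral>\<^sup>+h. insert_cost c st h \<partial>P)
        = (\<integral>\<^sup>+h. ennreal (real (c (probe_index s (stop s occ h), Suc (stop s occ h),
            enc (next_phase s (stop s occ h))))) \<partial>P)"
    proof (rule nn_integral_cong_AE)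
      show "AE h in P. insert_cost c st h = ennreal (real (c (probe_index s (stop s occ h), Suc (stop s occ h),
          enc (next_phase s (stop s occ h)))))"
        using AE_insert_key[OF 2(2) k]
        by eventually_elim (simp add: insert_cost_def 2(1) ennreal_of_nat_eq_real_of_nat)
    qed
    also have "\<dots> \<le> ennreal (B * (1 + psi s))" by (rule cost[OF 2(2)])
    also have "\<dots> = ennreal B * (1 + potential k st)"
      using B psi_nonneg[of s] by (simp add: 2(3) ennreal_mult ennreal_plus)
    finally show ?thesis .
  qed
  have "(\<integral>\<^sup>+\<omega>. insert_cost c (table alg \<omega> k) (\<omega> (Suc k)) \<partial>keys m P)
      = (\<integral>\<^sup>+\<omega>. (\<integral>\<^sup>+h. insert_cost c (table alg \<omega> k) h \<partial>P) \<partial>keys m P)"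
    using k by (intro nn_integral_table_key[OF insertion_algorithm_alg probe_distribution_P]
        measurable_insert_cost)
  also have "\<dots> \<le> (\<integral>\<^sup>+\<omega>. ennreal B * (1 + potential k (table alg \<omega> k)) \<partial>keys m P)"
    by (intro nn_integral_mono *)
  also have "\<dots> = ennreal B * (1 + (\<integral>\<^sup>+\<omega>. potential k (table alg \<omega> k) \<partial>keys m P))"
    using k measurable_state_fun[of k "potential k"]
    by (simp add: nn_integral_cmult nn_integral_add emeasure_space_1)
  also have "\<dots> \<le> ennreal B * (1 + 2)"
    using k by (intro mult_left_mono add_left_mono expected_potential) auto
  also have "\<dots> = ennreal (3 * B)"
    using B by (simp add: ennreal_mult' mult.commute)
  finally show ?thesis .
qed

section \<open>Bounds for the three cost measures\<close>

lemma probe_complexity_eq: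
  "probe_complexity alg (Suc k) \<omega> = insert_cost fst (table alg \<omega> k) (\<omega> (Suc k))"
  by (auto simp: probe_complexity_def outcome_def insert_cost_def split: option.splits)

lemma insertion_time_eq:
  "insertion_time alg (Suc k) \<omega> = insert_cost (\<lambda>r. fst (snd r)) (table alg \<omega> k) (\<omega> (Suc k))"
  by (auto simp: insertion_time_def outcome_def insert_cost_def split: option.splits)

lemma expected_insertion_time:
  assumes "k < m"
  shows "(\<integral>\<^sup>+\<omega>. insertion_time alg (Suc k) \<omega> \<partial>keys m P) \<le> ennreal (3 * (2050 * real p))"
  unfolding insertion_time_eq using p stop_cost[OF _ assms]
  by (intro insert_cost_le[OF assms]) simp_all

lemma expected_probe_complexity:
  assumes k: "k < m" and B: "\<And>occ s. inv k occ s \<Longrightarrow> real (weight (fst s)) \<le> B" "0 < B"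
  shows "(\<integral>\<^sup>+\<omega>. probe_complexity alg (Suc k) \<omega> \<partial>keys m P) \<le> ennreal (3 * (134217760 * B))"
  unfolding probe_complexity_eq
proof (rule insert_cost_le[OF k])
  fix occ s assume inv: "inv k occ s"
  have "134217760 * real (weight (fst s)) * (1 + psi s) \<le> 134217760 * B * (1 + psi s)"
    using B(1)[OF inv] psi_nonneg[of s] by (intro mult_right_mono mult_left_mono) auto
  then show "(\<integral>\<^sup>+h. ennreal (real (fst (probe_index s (stop s occ h), Suc (stop s occ h),
      enc (next_phase s (stop s occ h))))) \<partial>P) \<le> ennreal (134217760 * B * (1 + psi s))"
    using order_trans[OF probe_index_cost[OF inv k] ennreal_leI] by simp
qed (use B in simp)

lemma expected_probe_complexity_worst:
  assumes "k < m"
  shows "(\<integral>\<^sup>+\<omega>. probe_complexity alg (Suc k) \<omega> \<partial>keys m P) \<le> ennreal (3 * (134217760 * real p))"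
  using assms p weight_le_p by (intro expected_probe_complexity) auto

lemma expected_probe_complexity_at:
  assumes k: "k < m"
  shows "(\<integral>\<^sup>+\<omega>. probe_complexity alg (Suc k) \<omega> \<partial>keys m P)
    \<le> ennreal (3 * (134217760 * sqrt (2 * real n / (real n - real k))))"
proof (rule expected_probe_complexity[OF k])
  show "real (weight (fst s)) \<le> sqrt (2 * real n / (real n - real k))" if "inv k occ s" for occ s
  proof -
    have "2 ^ fst s \<le> 2 * real n / (real n - real k)"
      using phase_bound[of k occ "fst s" "fst (snd s)" "snd (snd s)"] that k by simp
    then show ?thesis using weight_le_sqrt[of "fst s"] real_sqrt_le_mono order_trans by blast
  qed
  have "real k < real n" using k by (simp add: m_def)
  then show "0 < sqrt (2 * real n / (real n - real k))" by simp
qed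

text \<open>A failed insertion has infinite insertion time, which a finite mean rules out almost
  surely.\<close>

lemma supports_insertions_alg: "supports_insertions P alg m"
  unfolding supports_insertions_def
proof (rule AE_finite_allI[OF finite_atLeastAtMost])
  fix k assume k: "k \<in> {1..m}"
  then obtain k' where k': "k = Suc k'" "k' < m" by (cases k) auto
  have "(\<integral>\<^sup>+\<omega>. insertion_time alg k \<omega> \<partial>keys m P) < \<infinity>"
    unfolding k' using expected_insertion_time[OF k'(2)] ennreal_less_top le_less_trans
    by (metis infinity_ennreal_def)
  moreover have "insertion_time alg k \<in> borel_measurable (keys m P)"
    using borel_measurable_costs[OF insertion_algorithm_alg probe_distribution_P, of k m] k by simp
  ultimately have "AE \<omega> in keys m P. insertion_time alg k \<omega> \<noteq> \<infinity>"
    by (intro nn_integral_PInf_AE) auto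
  then show "AE \<omega> in keys m P. outcome alg k \<omega> \<noteq> None"
    by eventually_elim (metis insertion_time_def option.simps(4))
qed

lemma m_ge: "real n / 2 \<le> real m" and m_le: "m \<le> n"
proof -
  have "n div 2 ^ p \<le> n div 2 ^ 1" using p by (intro div_le_mono2 power_increasing) auto
  then show "real n / 2 \<le> real m" unfolding m_def by simp
qed (simp add: m_def)

text \<open>The singularity \<open>1 / sqrt (n - k)\<close> is summable up to a full array, giving
  at most \<open>3 * n\<close> in total; division by \<open>m\<close>, at least
  \<open>n / 2\<close>, and the factor 3 from the potential produce 18.\<close>

lemma amortized_bound: "amortized_expected_probe_complexity P alg m \<le> ennreal (18 * 134217760)"
proof -
  define C :: real where "C = 3 * 134217760"
  have "(\<Sum>k<m. sqrt (2 * real n / (real n - real k))) \<le> (\<Sum>k<n. sqrt (2 * real n / (real n - real k)))"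
    using m_le by (intro sum_mono2) auto
  \<comment> \<open>Writing \<open>n - k\<close> as \<open>Suc (n - Suc k)\<close> puts the sum in
    the shape required by the reversal of indices.\<close>
  also have "\<dots> = (\<Sum>k<n. sqrt (2 * real n) * (1 / sqrt (real (Suc (n - Suc k)))))"
    by (intro sum.cong) (auto simp: real_sqrt_divide of_nat_diff)
  also have "\<dots> = sqrt (2 * real n) * (\<Sum>k<n. 1 / sqrt (real (Suc k)))"
    by (subst sum.nat_diff_reindex[symmetric]) (simp add: sum_distrib_left)
  also have "(\<Sum>k<n. 1 / sqrt (real (Suc k))) = (\<Sum>b=1..n. 1 / sqrt (real b))"
    by (simp add: sum.atLeast1_atMost_eq del: of_nat_Suc)
  also have "sqrt (2 * real n) * \<dots> \<le> sqrt (2 * real n) * (2 * sqrt (real n))"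
    by (intro mult_left_mono sum_inverse_sqrt_le) auto
  also have "\<dots> = 2 * sqrt 2 * real n" by (simp add: real_sqrt_mult)
  also have "\<dots> \<le> 3 * real n"
  proof (rule mult_right_mono)
    have "sqrt 2 \<le> 3 / 2" by (rule real_le_lsqrt) (auto simp: power2_eq_square)
    then show "2 * sqrt 2 \<le> 3" by simp
  qed simp
  finally have sum: "(\<Sum>k<m. sqrt (2 * real n / (real n - real k))) \<le> 3 * real n" .
  have meas: "probe_complexity alg k \<in> borel_measurable (keys m P)" if "k \<in> {1..m}" for k
    using borel_measurable_costs[OF insertion_algorithm_alg probe_distribution_P, of k m] that by simp
  have "amortized_expected_probe_complexity P alg m
      = (\<Sum>k=1..m. \<integral>\<^sup>+\<omega>. probe_complexity alg k \<omega> \<partial>keys m P) / of_nat m"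
    unfolding amortized_expected_probe_complexity_def
    by (subst nn_integral_divide[OF borel_measurable_sum[OF meas]])
      (simp_all only: nn_integral_sum[OF meas])
  also have "(\<Sum>k=1..m. \<integral>\<^sup>+\<omega>. probe_complexity alg k \<omega> \<partial>keys m P)
      = (\<Sum>k<m. \<integral>\<^sup>+\<omega>. probe_complexity alg (Suc k) \<omega> \<partial>keys m P)"
    by (simp add: sum.atLeast1_atMost_eq)
  also have "\<dots> \<le> (\<Sum>k<m. ennreal (C * sqrt (2 * real n / (real n - real k))))"
    using expected_probe_complexity_at by (intro sum_mono) (auto simp: C_def)
  also have "\<dots> = ennreal (\<Sum>k<m. C * sqrt (2 * real n / (real n - real k)))"
    using m_le by (intro sum_ennreal) (auto simp: C_def)
  also have "\<dots> \<le> ennreal (C * (3 * real n))"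
    using sum by (intro ennreal_leI) (simp add: C_def flip: sum_distrib_left)
  also have "ennreal (C * (3 * real n)) / of_nat m = ennreal (C * (3 * real n) / real m)"
    using m_ge n_ge by (simp add: divide_ennreal C_def ennreal_of_nat_eq_real_of_nat)
  also have "\<dots> \<le> ennreal (18 * 134217760)"
    using m_ge n_ge by (intro ennreal_leI) (simp add: C_def field_simps)
  finally show ?thesis by (simp add: divide_right_mono_ennreal)
qed

lemma SUP_insertions_le:
  fixes f :: "nat \<Rightarrow> ennreal"
  assumes "\<And>k. k < m \<Longrightarrow> f (Suc k) \<le> B"
  shows "(SUP k\<in>{1..m}. f k) \<le> B"
proof (rule SUP_least)
  fix k assume "k \<in> {1..m}"
  then show "f k \<le> B" using assms by (cases k) auto
qed

end

section \<open>Choice of the absolute constants\<close>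

theorem theorem1:
  shows "\<exists>(C\<^sub>0::real) (C\<^sub>1::real) (C\<^sub>2::real) (C\<^sub>3::real) (K::nat).
    C\<^sub>0 > 0 \<and> C\<^sub>1 > 0 \<and> C\<^sub>2 > 0 \<and> C\<^sub>3 > 0 \<and>
    (\<forall>(n::nat) (\<delta>::real).
      n \<ge> 1 \<and> 0 < \<delta> \<and> \<delta> < 1 \<and> \<delta> \<ge> C\<^sub>0 / real n \<and> (\<exists>p::nat. 1 / \<delta> = 2 ^ p) \<longrightarrow>
      (let m = n - nat \<lfloor>\<delta> * real n\<rfloor> in
        \<exists>P A. probe_distribution n P \<and> insertion_algorithm n (n ^ K) A \<and>
          supports_insertions P A m \<and>
          amortized_expected_probe_complexity P A m \<le> ennreal C\<^sub>1 \<and>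
          worst_case_expected_probe_complexity P A m \<le> ennreal (C\<^sub>2 * log 2 (1 / \<delta>)) \<and>
          worst_case_expected_insertion_time P A m \<le> ennreal (C\<^sub>3 * log 2 (1 / \<delta>))))"
proof (rule exI[of _ 65536], rule exI[of _ "18 * 134217760"], rule exI[of _ "3 * 134217760"],
    rule exI[of _ "3 * 2050"], rule exI[of _ 8], intro conjI allI impI)
  fix n :: nat and \<delta> :: real
  assume "n \<ge> 1 \<and> 0 < \<delta> \<and> \<delta> < 1 \<and> \<delta> \<ge> 65536 / real n \<and> (\<exists>p::nat. 1 / \<delta> = 2 ^ p)"
  then obtain p where n: "1 \<le> n" and \<delta>: "0 < \<delta>" "\<delta> < 1" "65536 / real n \<le> \<delta>" and "1 / \<delta> = 2 ^ p"
    by blast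
  then have \<delta>_eq: "\<delta> = 1 / 2 ^ p" by (simp add: field_simps)
  have "p \<noteq> 0"
  proof
    assume "p = 0"
    with \<delta>(2) show False by (simp add: \<delta>_eq)
  qed
  \<comment> \<open>For \<open>\<delta> = 1 / 2 ^ p\<close> the hypothesis on
    \<open>\<delta>\<close> is exactly the size condition of \<open>elastic\<close>, which gives
    every level at least 16384 slots.\<close>
  moreover have "real (65536 * 2 ^ p) \<le> real n" using \<delta>(3) n by (simp add: \<delta>_eq field_simps)
  then have "65536 * 2 ^ p \<le> n" by (simp only: of_nat_le_iff)
  ultimately interpret elastic n p by unfold_locales auto
  have "\<lfloor>\<delta> * real n\<rfloor> = \<lfloor>real n / real (2 ^ p)\<rfloor>" by (simp add: \<delta>_eq)
  then have m_eq: "n - nat \<lfloor>\<delta> * real n\<rfloor> = m"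
    unfolding m_def by (simp only: floor_divide_of_nat_eq nat_int)
  have log: "log 2 (1 / \<delta>) = real p" by (simp add: \<delta>_eq log_nat_power)
  have "worst_case_expected_probe_complexity P alg m \<le> ennreal (3 * 134217760 * log 2 (1 / \<delta>))"
    unfolding worst_case_expected_probe_complexity_def log
    using expected_probe_complexity_worst by (intro SUP_insertions_le) simp
  moreover have "worst_case_expected_insertion_time P alg m \<le> ennreal (3 * 2050 * log 2 (1 / \<delta>))"
    unfolding worst_case_expected_insertion_time_def log
    using expected_insertion_time by (intro SUP_insertions_le) simp
  ultimately show "let m = n - nat \<lfloor>\<delta> * real n\<rfloor> in
        \<exists>P A. probe_distribution n P \<and> insertion_algorithm n (n ^ 8) A \<and>
          supports_insertions P A m \<and>
          amortized_expected_probe_complexity P A m \<le> ennreal (18 * 134217760) \<and>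
          worst_case_expected_probe_complexity P A m \<le> ennreal (3 * 134217760 * log 2 (1 / \<delta>)) \<and>
          worst_case_expected_insertion_time P A m \<le> ennreal (3 * 2050 * log 2 (1 / \<delta>))"
    unfolding Let_def m_eq
    using probe_distribution_P insertion_algorithm_alg supports_insertions_alg amortized_bound by blast
qed simp_all

end
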